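(* A typical $T\in(\mathcal B_1(\ell_2),\mathrm{SOT}^* )$ has a non-trivial invariant subspace.
   Context: $\ell_2$ is the complex Hilbert space of square-summable sequences, and $\mathcal B_1(\ell_2)$ is the set of all bounded linear operators $T$ on $\ell_2$ with $\|T\|\le 1$. $\mathrm{SOT}^*$ (Strong$^*$ Operator Topology) is the topology of pointwise norm convergence of operators and of their adjoints; $(\mathcal B_1(\ell_2),\mathrm{SOT}^* )$ is a Polish space. "A typical $T$ satisfies (P)" means that the set of $T\in\mathcal B_1(\ell_2)$ satisfying (P) is comeager in $(\mathcal B_1(\ell_2),\mathrm{SOT}^* )$. A non-trivial invariant subspace of $T$ is a closed linear subspace $E$ with $E\ne\{0\}$, $E\neq \ell_2$ and $T(E)\subseteq E$. *)

theory Defs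
  imports "HOL-Analysis.Analysis"
begin

section \<open>The complex Hilbert space of square-summable sequences\<close>

typedef ell2 = "{x :: nat \<Rightarrow> complex. summable (\<lambda>n. (cmod (x n))\<^sup>2)}"
  morphisms ell2_nth Abs_ell2
  by (rule exI[of _ "\<lambda>_. 0"]) simp

setup_lifting type_definition_ell2

lemma summable_ell2_nth: "summable (\<lambda>n. (cmod (ell2_nth x n))\<^sup>2)"
  using ell2_nth[of x] by simp

lemma ell2_eqI: "(\<And>n. ell2_nth x n = ell2_nth y n) \<Longrightarrow> x = y"
  by (metis ell2_nth_inject ext)

lemma cmod_add_square_le: "(cmod (a + b))\<^sup>2 \<le> 2 * (cmod a)\<^sup>2 + 2 * (cmod b)\<^sup>2"
proof -
  have "(cmod (a + b))\<^sup>2 \<le> (cmod a + cmod b)\<^sup>2"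
    by (intro power_mono norm_triangle_ineq) auto
  also have "\<dots> \<le> 2 * (cmod a)\<^sup>2 + 2 * (cmod b)\<^sup>2"
    using sum_squares_ge_zero[of "cmod a - cmod b" 0] by (simp add: power2_eq_square algebra_simps)
  finally show ?thesis .
qed

lemma summable_cmod_square_add:
  assumes "summable (\<lambda>n. (cmod (x n))\<^sup>2)" "summable (\<lambda>n. (cmod (y n))\<^sup>2)"
  shows "summable (\<lambda>n. (cmod (x n + y n))\<^sup>2)"
proof (rule summable_comparison_test')
  show "summable (\<lambda>n. 2 * (cmod (x n))\<^sup>2 + 2 * (cmod (y n))\<^sup>2)"
    using assms by (intro summable_add summable_mult)
qed (use cmod_add_square_le in auto)

lemma summable_cmod_square_mult:
  "summable (\<lambda>n. (cmod (x n))\<^sup>2) \<Longrightarrow> summable (\<lambda>n. (cmod (c * x n))\<^sup>2)"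
  by (simp add: norm_mult power_mult_distrib summable_mult)

instantiation ell2 :: real_vector
begin

lift_definition zero_ell2 :: ell2 is "\<lambda>_. 0" by simp
lift_definition plus_ell2 :: "ell2 \<Rightarrow> ell2 \<Rightarrow> ell2" is "\<lambda>x y n. x n + y n"
  by (rule summable_cmod_square_add)
lift_definition uminus_ell2 :: "ell2 \<Rightarrow> ell2" is "\<lambda>x n. - x n" by simp
lift_definition minus_ell2 :: "ell2 \<Rightarrow> ell2 \<Rightarrow> ell2" is "\<lambda>x y n. x n - y n"
  subgoal for x y using summable_cmod_square_add[of x "\<lambda>n. - y n"] by simp
  done
lift_definition scaleR_ell2 :: "real \<Rightarrow> ell2 \<Rightarrow> ell2" is "\<lambda>r x n. r *\<^sub>R x n"
  by (simp add: power_mult_distrib summable_mult)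

instance
  by standard (transfer; simp add: fun_eq_iff algebra_simps)+

end

lift_definition scaleC :: "complex \<Rightarrow> ell2 \<Rightarrow> ell2"  (infixr \<open>*\<^sub>C\<close> 75) is "\<lambda>c x n. c * x n"
  by (rule summable_cmod_square_mult)

global_interpretation complex_vector: vector_space "(*\<^sub>C)"
  by standard (transfer; simp add: fun_eq_iff algebra_simps)+

lemma ell2_nth_zero [simp]: "ell2_nth 0 n = 0"
  by transfer simp

lemma ell2_nth_add [simp]: "ell2_nth (x + y) n = ell2_nth x n + ell2_nth y n"
  by transfer simp

lemma ell2_nth_diff [simp]: "ell2_nth (x - y) n = ell2_nth x n - ell2_nth y n"
  by transfer simp

lemma ell2_nth_scaleR [simp]: "ell2_nth (r *\<^sub>R x) n = r *\<^sub>R ell2_nth x n"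
  by transfer simp

lemma ell2_nth_scaleC [simp]: "ell2_nth (c *\<^sub>C x) n = c * ell2_nth x n"
  by transfer simp

definition cinner :: "ell2 \<Rightarrow> ell2 \<Rightarrow> complex" where
  "cinner x y = (\<Sum>n. ell2_nth x n * cnj (ell2_nth y n))"

lemma summable_cinner: "summable (\<lambda>n. ell2_nth x n * cnj (ell2_nth y n))"
proof (rule summable_comparison_test')
  show "summable (\<lambda>n. (cmod (ell2_nth x n))\<^sup>2 + (cmod (ell2_nth y n))\<^sup>2)"
    by (intro summable_add summable_ell2_nth)
  show "norm (ell2_nth x n * cnj (ell2_nth y n)) \<le> (cmod (ell2_nth x n))\<^sup>2 + (cmod (ell2_nth y n))\<^sup>2" for n
  proof -
    have "2 * (cmod (ell2_nth x n) * cmod (ell2_nth y n)) \<le> (cmod (ell2_nth x n))\<^sup>2 + (cmod (ell2_nth y n))\<^sup>2"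
      using sum_squares_bound[of "cmod (ell2_nth x n)" "cmod (ell2_nth y n)"] by (simp add: mult.assoc)
    moreover have "0 \<le> cmod (ell2_nth x n) * cmod (ell2_nth y n)" by simp
    ultimately have "cmod (ell2_nth x n) * cmod (ell2_nth y n) \<le> (cmod (ell2_nth x n))\<^sup>2 + (cmod (ell2_nth y n))\<^sup>2"
      by linarith
    then show ?thesis by (simp add: norm_mult)
  qed
qed

lemma cinner_add_left: "cinner (x + y) z = cinner x z + cinner y z"
  by (simp add: cinner_def suminf_add[OF summable_cinner summable_cinner] distrib_right)

lemma cinner_scaleC_left: "cinner (c *\<^sub>C x) y = c * cinner x y"
  by (simp add: cinner_def suminf_mult[OF summable_cinner] mult.assoc)

lemma cinner_scaleR_left: "cinner (r *\<^sub>R x) y = r *\<^sub>R cinner x y"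
  by (simp add: cinner_def suminf_scaleR_right[OF summable_cinner])

lemma cinner_commute: "cinner x y = cnj (cinner y x)"
proof -
  have "(\<lambda>n. cnj (ell2_nth y n * cnj (ell2_nth x n))) sums cnj (cinner y x)"
    unfolding cinner_def sums_cnj using summable_cinner by (rule summable_sums)
  then show ?thesis
    unfolding cinner_def by (simp add: sums_iff mult.commute)
qed

lemma cinner_self: "cinner x x = of_real (\<Sum>n. (cmod (ell2_nth x n))\<^sup>2)"
  unfolding cinner_def
  by (simp add: suminf_of_real[OF summable_ell2_nth] flip: complex_norm_square)

instantiation ell2 :: real_inner
begin

definition inner_ell2 :: "ell2 \<Rightarrow> ell2 \<Rightarrow> real" where
  "inner_ell2 x y = Re (cinner x y)"

definition norm_ell2 :: "ell2 \<Rightarrow> real" where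
  "norm_ell2 x = sqrt (\<Sum>n. (cmod (ell2_nth x n))\<^sup>2)"

definition sgn_ell2 :: "ell2 \<Rightarrow> ell2" where
  "sgn_ell2 x = x /\<^sub>R norm x"

definition dist_ell2 :: "ell2 \<Rightarrow> ell2 \<Rightarrow> real" where
  "dist_ell2 x y = norm (x - y)"

definition uniformity_ell2 :: "(ell2 \<times> ell2) filter" where
  "uniformity_ell2 = (INF e\<in>{0 <..}. principal {(x, y). dist x y < e})"

definition open_ell2 :: "ell2 set \<Rightarrow> bool" where
  "open_ell2 S = (\<forall>x\<in>S. \<forall>\<^sub>F (x', y) in uniformity. x' = x \<longrightarrow> y \<in> S)"

instance
proof
  fix x y z :: ell2 and r :: real
  show "inner x y = inner y x"
    unfolding inner_ell2_def using cinner_commute[of x y] by simp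
  show "inner (x + y) z = inner x z + inner y z"
    by (simp add: inner_ell2_def cinner_add_left)
  show "inner (r *\<^sub>R x) y = r * inner x y"
    by (simp add: inner_ell2_def cinner_scaleR_left)
  show "0 \<le> inner x x"
    by (simp add: inner_ell2_def cinner_self suminf_nonneg summable_ell2_nth)
  have "inner x x = 0 \<longleftrightarrow> (\<forall>n. ell2_nth x n = 0)"
    by (simp add: inner_ell2_def cinner_self suminf_eq_zero_iff summable_ell2_nth)
  also have "\<dots> \<longleftrightarrow> x = 0"
    by (metis ell2_eqI ell2_nth_zero)
  finally show "inner x x = 0 \<longleftrightarrow> x = 0" .
  show "norm x = sqrt (inner x x)"
    by (simp add: inner_ell2_def cinner_self norm_ell2_def)
qed (rule sgn_ell2_def dist_ell2_def uniformity_ell2_def open_ell2_def)+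

end

lemma norm_ell2_square: "(norm x)\<^sup>2 = (\<Sum>n. (cmod (ell2_nth x n))\<^sup>2)"
  by (simp add: norm_ell2_def suminf_nonneg summable_ell2_nth)

lemma cinner_self_norm: "cinner x x = of_real ((norm x)\<^sup>2)"
  by (simp add: cinner_self norm_ell2_square)

lemma norm_scaleC: "norm (c *\<^sub>C x) = cmod c * norm (x :: ell2)"
  by (simp add: norm_ell2_def norm_mult power_mult_distrib suminf_mult summable_ell2_nth real_sqrt_mult)

lemma sum_cmod_square_le: "finite A \<Longrightarrow> (\<Sum>n\<in>A. (cmod (ell2_nth x n))\<^sup>2) \<le> (norm x)\<^sup>2"
  unfolding norm_ell2_square by (intro sum_le_suminf summable_ell2_nth) auto

lemma cmod_ell2_nth_le: "cmod (ell2_nth x n) \<le> norm x"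
  using sum_cmod_square_le[of "{n}" x] by (simp add: power2_le_iff_abs_le)

lemma cmod_cinner_le: "cmod (cinner x y) \<le> norm x * norm y"
proof (cases "cinner x y = 0")
  case False
  define c where "c = cnj (cinner x y) / cmod (cinner x y)"
  have "cmod c = 1" using False by (simp add: c_def norm_divide)
  have "c * cinner x y = of_real (cmod (cinner x y))"
    using False by (simp add: c_def complex_norm_square[symmetric] power2_eq_square mult.commute)
  then have "cmod (cinner x y) = inner (c *\<^sub>C x) y"
    by (simp add: inner_ell2_def cinner_scaleC_left)
  also have "\<dots> \<le> norm x * norm y"
    using norm_cauchy_schwarz[of "c *\<^sub>C x" y] \<open>cmod c = 1\<close> by (simp add: norm_scaleC)
  finally show ?thesis .
qed simp

instance ell2 :: banach
proof
  fix X :: "nat \<Rightarrow> ell2"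
  assume "Cauchy X"
  define l where "l n = lim (\<lambda>k. ell2_nth (X k) n)" for n
  have "Cauchy (\<lambda>k. ell2_nth (X k) n)" for n
  proof (rule metric_CauchyI)
    fix e :: real assume "e > 0"
    then obtain M where "\<forall>i\<ge>M. \<forall>j\<ge>M. dist (X i) (X j) < e"
      using metric_CauchyD[OF \<open>Cauchy X\<close>] by blast
    moreover have "dist (ell2_nth (X i) n) (ell2_nth (X j) n) \<le> dist (X i) (X j)" for i j
      using cmod_ell2_nth_le[of "X i - X j" n] by (simp add: dist_norm)
    ultimately show "\<exists>M. \<forall>i\<ge>M. \<forall>j\<ge>M. dist (ell2_nth (X i) n) (ell2_nth (X j) n) < e"
      by (meson order.strict_trans1)
  qed
  then have l: "(\<lambda>k. ell2_nth (X k) n) \<longlonglongrightarrow> l n" for n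
    unfolding l_def by (intro convergent_LIMSEQ_iff[THEN iffD1] Cauchy_convergent)
  have bound: "(\<Sum>n<N. (cmod (ell2_nth (X i) n - l n))\<^sup>2) \<le> e\<^sup>2"
    if "\<forall>j\<ge>M. norm (X i - X j) < e" for M i N e
  proof (rule tendsto_upperbound)
    show "(\<lambda>j. \<Sum>n<N. (cmod (ell2_nth (X i) n - ell2_nth (X j) n))\<^sup>2)
        \<longlonglongrightarrow> (\<Sum>n<N. (cmod (ell2_nth (X i) n - l n))\<^sup>2)"
      by (intro tendsto_intros l)
    show "\<forall>\<^sub>F j in sequentially. (\<Sum>n<N. (cmod (ell2_nth (X i) n - ell2_nth (X j) n))\<^sup>2) \<le> e\<^sup>2"
    proof (rule eventually_sequentiallyI)
      fix j assume "M \<le> j"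
      have "(\<Sum>n<N. (cmod (ell2_nth (X i) n - ell2_nth (X j) n))\<^sup>2) \<le> (norm (X i - X j))\<^sup>2"
        using sum_cmod_square_le[of "{..<N}" "X i - X j"] by simp
      also have "\<dots> \<le> e\<^sup>2"
        using that \<open>M \<le> j\<close> by (intro power_mono) (auto intro: less_imp_le)
      finally show "(\<Sum>n<N. (cmod (ell2_nth (X i) n - ell2_nth (X j) n))\<^sup>2) \<le> e\<^sup>2" .
    qed
  qed simp
  have summ: "summable (\<lambda>n. (cmod (ell2_nth (X i) n - l n))\<^sup>2)"
    if "\<forall>j\<ge>M. norm (X i - X j) < e" for M i e
    using bound[OF that] by (intro bounded_imp_summable[where B = "e\<^sup>2"])
      (simp_all del: sum.lessThan_Suc flip: lessThan_Suc_atMost)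
  obtain M0 where M0: "\<forall>i\<ge>M0. \<forall>j\<ge>M0. norm (X i - X j) < 1"
    using metric_CauchyD[OF \<open>Cauchy X\<close>, of 1] by (auto simp: dist_norm)
  have "summable (\<lambda>n. (cmod (ell2_nth (X M0) n + - (ell2_nth (X M0) n - l n)))\<^sup>2)"
    using summ[of M0 M0 1] M0 
    by (intro summable_cmod_square_add[OF summable_ell2_nth]) (simp add: norm_minus_commute)
  then have "summable (\<lambda>n. (cmod (l n))\<^sup>2)" by simp
  then have L: "ell2_nth (Abs_ell2 l) = l" by (simp add: Abs_ell2_inverse)
  have "X \<longlonglongrightarrow> Abs_ell2 l"
  proof (rule metric_LIMSEQ_I)
    fix r :: real assume "r > 0"
    then obtain M where M: "\<forall>i\<ge>M. \<forall>j\<ge>M. norm (X i - X j) < r / 2"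
      using metric_CauchyD[OF \<open>Cauchy X\<close>, of "r / 2"] by (auto simp: dist_norm)
    have "dist (X i) (Abs_ell2 l) < r" if "i \<ge> M" for i
    proof -
      have *: "\<forall>j\<ge>M. norm (X i - X j) < r / 2" using M that by blast
      have "(norm (X i - Abs_ell2 l))\<^sup>2 \<le> (r / 2)\<^sup>2"
        unfolding norm_ell2_square ell2_nth_diff L
        by (intro suminf_le_const[OF summ[OF *]] bound[OF *])
      then have "norm (X i - Abs_ell2 l) \<le> r / 2"
        using \<open>r > 0\<close> by (simp add: power2_le_iff_abs_le)
      then show ?thesis using \<open>r > 0\<close> by (simp add: dist_norm)
    qed
    then show "\<exists>M. \<forall>i\<ge>M. dist (X i) (Abs_ell2 l) < r" by blast
  qed
  then show "convergent X" by (rule convergentI)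
qed

section \<open>Bounded complex-linear operators and adjoints\<close>

text \<open>Elements of \<^typ>\<open>ell2 \<Rightarrow>\<^sub>L ell2\<close> are only real-linear; the operators
  on the complex Hilbert space are those that are also linear for \<^term>\<open>(*\<^sub>C)\<close>.
  The norm of \<^typ>\<open>ell2 \<Rightarrow>\<^sub>L ell2\<close> is the operator norm.\<close>

definition clinear_op :: "(ell2 \<Rightarrow>\<^sub>L ell2) \<Rightarrow> bool" where
  "clinear_op T \<longleftrightarrow> Vector_Spaces.linear (*\<^sub>C) (*\<^sub>C) (blinfun_apply T)"

definition contractions :: "(ell2 \<Rightarrow>\<^sub>L ell2) set" where
  "contractions = {T. clinear_op T \<and> norm T \<le> 1}"

definition adj :: "(ell2 \<Rightarrow>\<^sub>L ell2) \<Rightarrow> (ell2 \<Rightarrow>\<^sub>L ell2)" where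
  "adj T = (THE S. \<forall>x y. cinner (blinfun_apply T x) y = cinner x (blinfun_apply S y))"

text \<open>For complex-linear \<open>T\<close> the description in \<open>adj_def\<close> determines a unique operator:\<close>

lift_definition unit_ell2 :: "nat \<Rightarrow> ell2" is "\<lambda>k n. if n = k then 1 else 0"
  subgoal for k by (rule summable_finite[of "{k}"]) auto
  done

lemma ell2_nth_unit: "ell2_nth (unit_ell2 k) n = (if n = k then 1 else 0)"
  by transfer simp

lemma ell2_nth_sum: "ell2_nth (\<Sum>k\<in>A. f k) n = (\<Sum>k\<in>A. ell2_nth (f k) n)"
  by (induction A rule: infinite_finite_induct) auto

lemma ell2_nth_unit_sum:
  "ell2_nth (\<Sum>k<N. s k *\<^sub>C unit_ell2 k) n = (if n < N then s n else 0)"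
proof -
  have "ell2_nth (\<Sum>k<N. s k *\<^sub>C unit_ell2 k) n = (\<Sum>k<N. if k = n then s k else 0)"
    unfolding ell2_nth_sum by (intro sum.cong) (auto simp: ell2_nth_unit)
  then show ?thesis by simp
qed

lemma norm_unit_sum: "(norm (\<Sum>k<N. s k *\<^sub>C unit_ell2 k))\<^sup>2 = (\<Sum>n<N. (cmod (s n))\<^sup>2)"
  unfolding norm_ell2_square
  by (subst suminf_finite[of "{..<N}"]) (auto simp: ell2_nth_unit_sum)

lemma unit_sum_tendsto: "(\<lambda>N. \<Sum>k<N. ell2_nth x k *\<^sub>C unit_ell2 k) \<longlonglongrightarrow> x"
proof -
  let ?P = "\<lambda>N. \<Sum>k<N. ell2_nth x k *\<^sub>C unit_ell2 k"
  have eq: "(norm (?P N - x))\<^sup>2 = (norm x)\<^sup>2 - (\<Sum>n<N. (cmod (ell2_nth x n))\<^sup>2)" for N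
  proof -
    have "(norm (?P N - x))\<^sup>2 = (\<Sum>n. (cmod (ell2_nth x n))\<^sup>2 - (if n < N then (cmod (ell2_nth x n))\<^sup>2 else 0))"
      unfolding norm_ell2_square by (intro suminf_cong) (simp add: ell2_nth_unit_sum)
    also have "\<dots> = (norm x)\<^sup>2 - (\<Sum>n. if n < N then (cmod (ell2_nth x n))\<^sup>2 else 0)"
      unfolding norm_ell2_square
      by (intro suminf_diff[symmetric] summable_ell2_nth summable_finite[of "{..<N}"]) auto
    also have "(\<Sum>n. if n < N then (cmod (ell2_nth x n))\<^sup>2 else 0) = (\<Sum>n<N. (cmod (ell2_nth x n))\<^sup>2)"
      by (subst suminf_finite[of "{..<N}"]) auto
    finally show ?thesis .
  qed
  have "(\<lambda>N. \<Sum>n<N. (cmod (ell2_nth x n))\<^sup>2) \<longlonglongrightarrow> (norm x)\<^sup>2"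
    unfolding norm_ell2_square using summable_LIMSEQ[OF summable_ell2_nth] .
  then have "(\<lambda>N. (norm (?P N - x))\<^sup>2) \<longlonglongrightarrow> 0"
    unfolding eq using tendsto_diff[OF tendsto_const[of "(norm x)\<^sup>2"]] by fastforce
  then have "(\<lambda>N. sqrt ((norm (?P N - x))\<^sup>2)) \<longlonglongrightarrow> 0"
    using tendsto_real_sqrt[of _ 0] by fastforce
  then show ?thesis
    by (simp add: LIM_zero_iff tendsto_norm_zero_iff)
qed

lemma cinner_add_right: "cinner x (y + z) = cinner x y + cinner x z"
  using cinner_add_left[of y z x] by (metis cinner_commute complex_cnj_add)

lemma cinner_scaleR_right: "cinner x (r *\<^sub>R y) = r *\<^sub>R cinner x y"
  by (subst (1 2) cinner_commute) (simp add: cinner_scaleR_left)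

lemma cinner_scaleC_right: "cinner x (c *\<^sub>C y) = cnj c * cinner x y"
  by (subst (1 2) cinner_commute) (simp add: cinner_scaleC_left)

lemma bounded_linear_cinner_left: "bounded_linear (\<lambda>x. cinner x y)"
  by (rule bounded_linear_intro[where K = "norm y"])
    (simp_all add: cinner_add_left cinner_scaleR_left cmod_cinner_le)

lemma bounded_linear_cinner_right: "bounded_linear (cinner x)"
  by (rule bounded_linear_intro[where K = "norm x"])
    (simp_all add: cinner_add_right cinner_scaleR_right cmod_cinner_le mult.commute[of "norm _" "norm x"])

lemma cinner_ext_right: "(\<And>x. cinner x y = cinner x z) \<Longrightarrow> y = z"
proof -
  assume *: "\<And>x. cinner x y = cinner x z"
  have "cinner (y - z) (y - z) = 0"
    using * by (simp add: bounded_linear.linear[OF bounded_linear_cinner_right] linear_diff)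
  then show "y = z" by (simp add: cinner_self_norm)
qed

lemma clinear_op_unit_sum:
  assumes "clinear_op T"
  shows "blinfun_apply T (\<Sum>k<N. s k *\<^sub>C unit_ell2 k) = (\<Sum>k<N. s k *\<^sub>C blinfun_apply T (unit_ell2 k))"
proof -
  interpret Vector_Spaces.linear "(*\<^sub>C)" "(*\<^sub>C)" "blinfun_apply T"
    using assms by (simp add: clinear_op_def)
  show ?thesis by (simp add: sum scale)
qed

lemma adjoint_exists:
  assumes "clinear_op T"
  shows "\<exists>S. \<forall>x y. cinner (blinfun_apply T x) y = cinner x (blinfun_apply S y)"
proof -
  define s where "s y n = cinner y (blinfun_apply T (unit_ell2 n))" for y n
  have bound: "(\<Sum>n<N. (cmod (s y n))\<^sup>2) \<le> (norm T * norm y)\<^sup>2" for y N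
  proof -
    define z where "z = (\<Sum>k<N. s y k *\<^sub>C unit_ell2 k)"
    have z: "(norm z)\<^sup>2 = (\<Sum>n<N. (cmod (s y n))\<^sup>2)"
      by (simp add: z_def norm_unit_sum)
    have "cinner y (blinfun_apply T z) = (\<Sum>n<N. cnj (s y n) * s y n)"
      by (simp add: z_def clinear_op_unit_sum[OF assms] cinner_scaleC_right s_def
          bounded_linear.linear[OF bounded_linear_cinner_right] linear_sum)
    also have "\<dots> = of_real ((norm z)\<^sup>2)"
      unfolding z of_real_sum by (intro sum.cong) (simp_all only: complex_norm_square mult.commute)
    finally have "(norm z)\<^sup>2 = cmod (cinner y (blinfun_apply T z))"
      by (simp add: norm_power)
    also have "\<dots> \<le> norm y * (norm T * norm z)"
      using cmod_cinner_le by (rule order_trans) (intro mult_left_mono norm_blinfun norm_ge_zero)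
    finally have "norm z * norm z \<le> (norm T * norm y) * norm z"
      by (simp add: power2_eq_square algebra_simps)
    then have "norm z \<le> norm T * norm y"
      by (cases "norm z = 0") (simp_all add: mult_le_cancel_right)
    then show ?thesis
      unfolding z[symmetric] by (intro power_mono) auto
  qed
  have summ: "summable (\<lambda>n. (cmod (s y n))\<^sup>2)" for y
    using bound[of y] by (intro bounded_imp_summable[where B = "(norm T * norm y)\<^sup>2"])
      (simp_all del: sum.lessThan_Suc flip: lessThan_Suc_atMost)
  define S where "S y = Abs_ell2 (s y)" for y
  have nth_S: "ell2_nth (S y) = s y" for y
    by (simp add: S_def Abs_ell2_inverse summ)
  have adj: "cinner (blinfun_apply T x) y = cinner x (S y)" for x y
  proof (rule LIMSEQ_unique)
    let ?P = "\<lambda>N. \<Sum>k<N. ell2_nth x k *\<^sub>C unit_ell2 k"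
    show "(\<lambda>N. cinner (blinfun_apply T (?P N)) y) \<longlonglongrightarrow> cinner (blinfun_apply T x) y"
      by (intro bounded_linear.tendsto[OF bounded_linear_cinner_left]
          bounded_linear.tendsto[OF blinfun.bounded_linear_right] unit_sum_tendsto)
    have "cinner (blinfun_apply T (?P N)) y = (\<Sum>n<N. ell2_nth x n * cnj (s y n))" for N
      by (simp add: clinear_op_unit_sum[OF assms] cinner_scaleC_left s_def
          linear_sum[OF bounded_linear.linear[OF bounded_linear_cinner_left]] cinner_commute[symmetric])
    then show "(\<lambda>N. cinner (blinfun_apply T (?P N)) y) \<longlonglongrightarrow> cinner x (S y)"
      using summable_LIMSEQ[OF summable_cinner[of x "S y"]] by (simp add: cinner_def nth_S)
  qed
  have "bounded_linear S"
  proof (rule bounded_linear_intro)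
    show "S (y + z) = S y + S z" for y z
      by (rule cinner_ext_right) (simp add: cinner_add_right flip: adj)
    show "S (r *\<^sub>R y) = r *\<^sub>R S y" for r y
      by (rule cinner_ext_right) (simp add: cinner_scaleR_right flip: adj)
    show "norm (S y) \<le> norm y * norm T" for y
    proof -
      have "(norm (S y))\<^sup>2 \<le> (norm T * norm y)\<^sup>2"
        unfolding norm_ell2_square nth_S by (intro suminf_le_const summ bound)
      then show ?thesis by (simp add: power2_le_iff_abs_le mult.commute)
    qed
  qed
  then show ?thesis
    using adj by (intro exI[of _ "Blinfun S"]) (simp add: bounded_linear_Blinfun_apply)
qed

lemma cinner_adj:
  assumes "clinear_op T"
  shows "cinner (blinfun_apply T x) y = cinner x (blinfun_apply (adj T) y)"
proof -
  let ?P = "\<lambda>S. \<forall>x y. cinner (blinfun_apply T x) y = cinner x (blinfun_apply S y)"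
  obtain S where S: "?P S" using adjoint_exists[OF assms] by blast
  have "?P (adj T)"
    unfolding adj_def
  proof (rule theI[of ?P, OF S])
    fix R assume R: "?P R"
    show "R = S"
    proof (intro blinfun_eqI cinner_ext_right)
      show "cinner x (blinfun_apply R y) = cinner x (blinfun_apply S y)" for x y
        using R[rule_format, of x y] S[rule_format, of x y] by (rule trans[OF sym])
    qed
  qed
  then show ?thesis by blast
qed

section \<open>The strong-star operator topology\<close>

text \<open>The coarsest topology on the contractions making \<open>T \<mapsto> T\<close> and \<open>T \<mapsto> T\<^sup>*\<close> continuous into the
  strong operator topology.\<close>

definition SOT_star :: "(ell2 \<Rightarrow>\<^sub>L ell2) topology" where
  "SOT_star = pullback_topology contractions (\<lambda>T. (T, adj T))
     (prod_topology strong_operator_topology strong_operator_topology)"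

lemma topspace_SOT_star: "topspace SOT_star = contractions"
  unfolding SOT_star_def topspace_pullback_topology topspace_prod_topology strong_operator_topology_topspace by simp

section \<open>Baire category and invariant subspaces\<close>

definition nowhere_dense_in :: "'a topology \<Rightarrow> 'a set \<Rightarrow> bool" where
  "nowhere_dense_in X A \<longleftrightarrow> A \<subseteq> topspace X \<and> X interior_of (X closure_of A) = {}"

definition meager_in :: "'a topology \<Rightarrow> 'a set \<Rightarrow> bool" where
  "meager_in X A \<longleftrightarrow> (\<exists>\<F>. countable \<F> \<and> (\<forall>N\<in>\<F>. nowhere_dense_in X N) \<and> A = \<Union>\<F>)"

definition comeager_in :: "'a topology \<Rightarrow> 'a set \<Rightarrow> bool" where
  "comeager_in X A \<longleftrightarrow> A \<subseteq> topspace X \<and> meager_in X (topspace X - A)"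

definition nontrivial_invariant_subspace :: "(ell2 \<Rightarrow>\<^sub>L ell2) \<Rightarrow> ell2 set \<Rightarrow> bool" where
  "nontrivial_invariant_subspace T E \<longleftrightarrow>
     complex_vector.subspace E \<and> closed E \<and> E \<noteq> {0} \<and> E \<noteq> UNIV \<and> blinfun_apply T ` E \<subseteq> E"

end

theory Submission
  imports Defs
begin

text \<open>For a typical contraction \<open>T\<close> there are \<open>x, y\<close> with \<open>\<langle>T\<^sup>n x, y\<rangle> = \<delta>\<^sub>n\<^sub>0\<close> for all \<open>n\<close>, so that
  \<open>{z. \<forall>n. \<langle>T\<^sup>n z, y\<rangle> = 0}\<close> is a closed invariant subspace that contains \<open>T x\<close> but not \<open>x\<close>; it is
  non-trivial unless \<open>T x = 0\<close>, in which case the kernel of \<open>T\<close> serves instead.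

  The pair is a limit of approximate ones. Suppose that \<open>\<langle>T\<^sup>n x, y\<rangle>\<close> is close to \<open>\<delta>\<^sub>n\<^sub>0\<close> for \<open>n < K\<close>
  and that \<open>K \<parallel>T\<^sup>K x\<parallel>\<close> is small. The contractions \<open>r (C \<oplus> B)\<close>, where \<open>r < 1\<close>, \<open>C\<close> is
  \<open>r\<close> times a large finite section of \<open>T\<close>, and \<open>B\<close> is a backward shift of infinite multiplicity on the
  remaining coordinates, tend to \<open>T\<close> in the strong-star topology. Since \<open>B\<close> contains a copy of \<open>C\<close>,
  small components along \<open>B\<close> can be added to \<open>x\<close> and \<open>y\<close> so that the relation holds exactly
  for \<open>r (C \<oplus> B)\<close>. Hence the contractions for which the pair cannot be improved by a small
  perturbation form a nowhere dense set; countably many such sets suffice.\<close>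

section \<open>Complex-linear operators and their adjoints\<close>

lemma clinear_op_iff: "clinear_op T \<longleftrightarrow> (\<forall>c x. T (c *\<^sub>C x) = c *\<^sub>C T x)"
  by (simp add: clinear_op_def Vector_Spaces.linear_iff complex_vector.vector_space_axioms
      blinfun.add_right)

lemma clinear_op_scaleC: "clinear_op T \<Longrightarrow> T (c *\<^sub>C x) = c *\<^sub>C T x"
  by (simp add: clinear_op_iff)

lemma cinner_diff_left: "cinner (x - y) z = cinner x z - cinner y z"
  by (rule linear_diff[OF bounded_linear.linear[OF bounded_linear_cinner_left]])

lemma cinner_diff_right: "cinner z (x - y) = cinner z x - cinner z y"
  by (rule linear_diff[OF bounded_linear.linear[OF bounded_linear_cinner_right]])

lemma cinner_zero_left [simp]: "cinner 0 z = 0"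
  by (rule linear_0[OF bounded_linear.linear[OF bounded_linear_cinner_left]])

lemma cinner_zero_right [simp]: "cinner z 0 = 0"
  by (rule linear_0[OF bounded_linear.linear[OF bounded_linear_cinner_right]])

lemma cinner_sum_left: "cinner (\<Sum>i\<in>A. f i) z = (\<Sum>i\<in>A. cinner (f i) z)"
  by (rule linear_sum[OF bounded_linear.linear[OF bounded_linear_cinner_left]])

lemma tendsto_cinner [tendsto_intros]:
  assumes "(f \<longlongrightarrow> x) F" "(g \<longlongrightarrow> y) F"
  shows "((\<lambda>i. cinner (f i) (g i)) \<longlongrightarrow> cinner x y) F"
proof -
  have "bounded_bilinear cinner"
    by standard (auto simp: cinner_add_left cinner_add_right cinner_scaleR_left cinner_scaleR_right
        intro!: exI[of _ 1] cmod_cinner_le)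
  then show ?thesis using assms by (rule bounded_bilinear.tendsto)
qed

lemma scaleR_scaleC: "r *\<^sub>R (x :: ell2) = of_real r *\<^sub>C x"
  by (rule ell2_eqI) (simp add: scaleR_conv_of_real)

lemma scaleC_add_right: "c *\<^sub>C (x + y) = c *\<^sub>C x + c *\<^sub>C y"
  by (rule complex_vector.scale_right_distrib)

lemma scaleC_diff_right: "c *\<^sub>C (x - y) = c *\<^sub>C x - c *\<^sub>C y"
  by (rule complex_vector.scale_right_diff_distrib)

lemma norm_sq_add_orthogonal:
  assumes "cinner x y = 0"
  shows "(norm (x + y))\<^sup>2 = (norm x)\<^sup>2 + (norm y)\<^sup>2"
proof -
  have "cinner y x = 0" using assms cinner_commute[of y x] by simp
  then have "complex_of_real ((norm (x + y))\<^sup>2) = of_real ((norm x)\<^sup>2 + (norm y)\<^sup>2)"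
    using assms unfolding of_real_add cinner_self_norm[symmetric]
    by (simp add: cinner_add_left cinner_add_right)
  then show ?thesis unfolding of_real_eq_iff .
qed

lemma norm_eq_if_cinner_self_eq: "cinner x x = cinner y y \<Longrightarrow> norm x = norm y"
  unfolding cinner_self_norm of_real_eq_iff by simp

lemma cinner_adj': "clinear_op T \<Longrightarrow> cinner (adj T x) y = cinner x (T y)"
  using cinner_adj[of T y x] by (metis cinner_commute)

lemma cinner_ext_left: "(\<And>y. cinner x y = cinner z y) \<Longrightarrow> x = z"
  by (metis cinner_commute cinner_ext_right)

lemma clinear_op_adj: assumes "clinear_op T" shows "clinear_op (adj T)"
  unfolding clinear_op_iff
  by (intro allI cinner_ext_left) (simp add: cinner_adj'[OF assms] cinner_scaleC_left)

lemma adj_eqI: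
  fixes T S :: "ell2 \<Rightarrow>\<^sub>L ell2"
  assumes "clinear_op T" "\<And>x y. cinner (T x) y = cinner x (S y)"
  shows "adj T = S"
  by (intro blinfun_eqI cinner_ext_right) (metis assms cinner_adj)

lemma norm_adj_le: assumes "clinear_op T" shows "norm (adj T) \<le> norm T"
proof (rule norm_blinfun_bound)
  fix y
  have "(norm (adj T y))\<^sup>2 = cmod (cinner (T (adj T y)) y)"
    by (simp add: cinner_adj[OF assms] cinner_self_norm norm_power)
  also have "\<dots> \<le> norm (T (adj T y)) * norm y" by (rule cmod_cinner_le)
  also have "\<dots> \<le> norm T * norm (adj T y) * norm y"
    by (intro mult_right_mono norm_blinfun) auto
  finally show "norm (adj T y) \<le> norm T * norm y"
    by (cases "norm (adj T y) = 0") (simp_all add: power2_eq_square mult_le_cancel_right algebra_simps)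
qed simp

section \<open>Iterates of bounded operators\<close>

abbreviation iter :: "('a::real_normed_vector \<Rightarrow>\<^sub>L 'a) \<Rightarrow> nat \<Rightarrow> 'a \<Rightarrow> 'a" where
  "iter T n \<equiv> blinfun_apply T ^^ n"

lemma contraction_norm_le:
  fixes T :: "ell2 \<Rightarrow>\<^sub>L ell2" assumes "norm T \<le> 1" shows "norm (T x) \<le> norm x"
  using norm_blinfun[of T x] mult_right_mono[OF assms, of "norm x"] by simp

lemma contraction_funpow_norm_le:
  fixes T :: "ell2 \<Rightarrow>\<^sub>L ell2" assumes "norm T \<le> 1" shows "norm (iter T n x) \<le> norm x"
  by (induction n) (auto intro: order_trans[OF contraction_norm_le[OF assms]])

lemma strict_contraction_funpow_norm_le:
  fixes T :: "ell2 \<Rightarrow>\<^sub>L ell2" assumes "norm T \<le> r" "0 \<le> r"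
  shows "norm (iter T n x) \<le> r ^ n * norm x"
proof (induction n)
  case (Suc n)
  have "norm (iter T (Suc n) x) \<le> norm T * norm (iter T n x)" by (simp add: norm_blinfun)
  also have "\<dots> \<le> r * (r ^ n * norm x)" using assms Suc by (intro mult_mono) auto
  finally show ?case by (simp add: mult.assoc)
qed simp

lemma funpow_add_apply:
  fixes T :: "'a::real_normed_vector \<Rightarrow>\<^sub>L 'a"
  shows "iter T n (x + y) = iter T n x + iter T n y"
  by (induction n) (auto simp: blinfun.add_right)

lemma funpow_scaleR_apply:
  fixes T :: "'a::real_normed_vector \<Rightarrow>\<^sub>L 'a"
  shows "iter T n (c *\<^sub>R x) = c *\<^sub>R iter T n x"
  by (induction n) (auto simp: blinfun.scaleR_right)

lemma funpow_scaleC_apply: "clinear_op T \<Longrightarrow> iter T n (c *\<^sub>C x) = c *\<^sub>C iter T n x"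
  by (induction n) (auto simp: clinear_op_scaleC)

lemma funpow_zero_apply [simp]:
  fixes T :: "'a::real_normed_vector \<Rightarrow>\<^sub>L 'a"
  shows "iter T n 0 = 0"
  by (induction n) (auto simp: blinfun.zero_right)

lemma funpow_sum_apply:
  fixes T :: "'a::real_normed_vector \<Rightarrow>\<^sub>L 'a"
  shows "iter T n (\<Sum>i\<in>A. f i) = (\<Sum>i\<in>A. iter T n (f i))"
  by (induction A rule: infinite_finite_induct) (auto simp: funpow_add_apply)

lemma cinner_unit: "cinner x (unit_ell2 n) = ell2_nth x n"
  unfolding cinner_def by (subst suminf_finite[of "{n}"]) (auto simp: ell2_nth_unit)

section \<open>Composition with an injection of the index set\<close>

text \<open>For injective \<open>f\<close> this is a coisometry whose adjoint places a sequence
  along \<open>range f\<close> and fills the gaps with zeros. The index maps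
  \<open>2 * n + 1\<close>, \<open>2 * n + 2\<close> and \<open>n + N\<close> provide the shift, an
  embedding into its kernel and the truncation. The lemmas assume \<open>inj f\<close>, since
  otherwise the composed sequence can fail to be square-summable.\<close>

definition pull :: "(nat \<Rightarrow> nat) \<Rightarrow> ell2 \<Rightarrow>\<^sub>L ell2" where
  "pull f = Blinfun (\<lambda>x. Abs_ell2 (\<lambda>n. ell2_nth x (f n)))"

context
  fixes f :: "nat \<Rightarrow> nat" assumes inj: "inj f"
begin

private lemma nth_Abs: "ell2_nth (Abs_ell2 (\<lambda>n. ell2_nth x (f n))) n = ell2_nth x (f n)"
  using summable_reindex[OF summable_ell2_nth inj, of x] by (simp add: Abs_ell2_inverse o_def)

private lemma norm_Abs_le: "norm (Abs_ell2 (\<lambda>n. ell2_nth x (f n))) \<le> norm x"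
proof (rule power2_le_imp_le)
  show "(norm (Abs_ell2 (\<lambda>n. ell2_nth x (f n))))\<^sup>2 \<le> (norm x)\<^sup>2"
    unfolding norm_ell2_square nth_Abs
    using suminf_reindex_mono[OF summable_ell2_nth inj, of x] by (simp add: o_def)
qed simp

private lemma pull_apply: "pull f x = Abs_ell2 (\<lambda>n. ell2_nth x (f n))"
proof -
  have "bounded_linear (\<lambda>x. Abs_ell2 (\<lambda>n. ell2_nth x (f n)))"
  proof (rule bounded_linear_intro[where K = 1])
    show "Abs_ell2 (\<lambda>n. ell2_nth (x + y) (f n))
        = Abs_ell2 (\<lambda>n. ell2_nth x (f n)) + Abs_ell2 (\<lambda>n. ell2_nth y (f n))" for x y
      by (rule ell2_eqI, subst nth_Abs) (simp add: nth_Abs)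
    show "Abs_ell2 (\<lambda>n. ell2_nth (r *\<^sub>R x) (f n)) = r *\<^sub>R Abs_ell2 (\<lambda>n. ell2_nth x (f n))" for r x
      by (rule ell2_eqI, subst nth_Abs) (simp add: nth_Abs)
  qed (simp add: norm_Abs_le)
  then show ?thesis by (simp add: pull_def bounded_linear_Blinfun_apply)
qed

lemma pull_nth [simp]: "ell2_nth (pull f x) n = ell2_nth x (f n)"
  by (simp add: pull_apply nth_Abs)

lemma norm_pull_le: "norm (pull f) \<le> 1"
  by (rule norm_blinfun_bound) (auto simp: pull_apply norm_Abs_le)

lemma clinear_pull: "clinear_op (pull f)"
  unfolding clinear_op_iff by (auto intro: ell2_eqI)

text \<open>Coordinates are inner products with unit vectors, and \<open>pull f\<close> sends each
  unit vector to a unit vector or to zero.\<close>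

lemma adj_pull_nth: "ell2_nth (adj (pull f) x) n = (if n \<in> range f then ell2_nth x (inv f n) else 0)"
proof -
  have "f k = n \<longleftrightarrow> n \<in> range f \<and> k = inv f n" for k
    by (metis inj f_inv_into_f inv_f_f rangeI)
  then have "pull f (unit_ell2 n) = (if n \<in> range f then unit_ell2 (inv f n) else 0)"
    by (intro ell2_eqI) (auto simp: ell2_nth_unit)
  then show ?thesis
    unfolding cinner_unit[symmetric] cinner_adj'[OF clinear_pull] by auto
qed

lemma pull_adj_pull [simp]: "pull f (adj (pull f) x) = x"
  by (rule ell2_eqI) (simp add: adj_pull_nth inj)

lemma cinner_adj_pull_adj_pull [simp]: "cinner (adj (pull f) x) (adj (pull f) y) = cinner x y"
  by (simp add: cinner_adj'[OF clinear_pull])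

lemma norm_adj_pull [simp]: "norm (adj (pull f) x) = norm x"
  by (rule norm_eq_if_cinner_self_eq) simp

end

lemma pull_adj_pull_disjoint:
  assumes "inj f" "inj g" "range f \<inter> range g = {}"
  shows "pull f (adj (pull g) x) = 0"
  using assms by (intro ell2_eqI) (auto simp: adj_pull_nth)

section \<open>Modelling strict contractions by a backward shift\<close>

text \<open>The defect operator is found as \<open>D = 1 - Y\<close>, where \<open>Y\<close> is the fixed point of
  \<open>Y \<mapsto> (C\<^sup>* C + Y\<^sup>2) / 2\<close>, so that \<open>D\<^sup>2 = 1 - C\<^sup>* C\<close>.\<close>

lemma defect_operator_exists:
  assumes C: "clinear_op C" and r: "norm C \<le> r" "r < 1"
  obtains D :: "ell2 \<Rightarrow>\<^sub>L ell2"
    where "\<And>h k. cinner (D h) (D k) = cinner h k - cinner (C h) (C k)"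
proof -
  have r0: "0 \<le> r" using norm_ge_zero r(1) by (rule order_trans)
  define A where "A = adj C o\<^sub>L C"
  have "norm A \<le> norm (adj C) * norm C" unfolding A_def by (rule norm_blinfun_compose)
  also have "\<dots> \<le> r * r"
    using norm_adj_le[OF C] r r0 by (intro mult_mono) auto
  finally have A: "norm A \<le> r * r" .
  have A_sym: "cinner (A x) y = cinner x (A y)" for x y
    by (simp add: A_def cinner_adj'[OF C] cinner_adj[OF C])
  \<comment> \<open>The radius \<open>r\<close> suits both hypotheses of the fixed point theorem:
    \<open>(r * r + r * r) / 2 \<le> r\<close>, and the Lipschitz constant is
    \<open>(r + r) / 2 = r\<close>. Symmetry is kept so that \<open>1 - Y\<close> is
    self-adjoint.\<close>
  define S where "S = {Y :: ell2 \<Rightarrow>\<^sub>L ell2. norm Y \<le> r \<and> (\<forall>x y. cinner (blinfun_apply Y x) y = cinner x (blinfun_apply Y y))}"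
  define F where "F Y = (1/2) *\<^sub>R (A + (Y o\<^sub>L Y))" for Y :: "ell2 \<Rightarrow>\<^sub>L ell2"
  have "\<exists>!Y\<in>S. F Y = Y"
  proof (rule Banach_fix)
    have "closed S"
    proof (unfold closed_sequential_limits, intro allI impI, elim conjE)
      fix X :: "nat \<Rightarrow> ell2 \<Rightarrow>\<^sub>L ell2" and L
      assume XS: "\<forall>n. X n \<in> S" and lim: "X \<longlonglongrightarrow> L"
      have "norm L \<le> r"
        using XS by (intro Lim_bounded[OF tendsto_norm[OF lim], of 0]) (auto simp: S_def)
      moreover have "cinner (L x) y = cinner x (L y)" for x y
      proof (rule LIMSEQ_unique)
        have ev: "(\<lambda>n. X n z) \<longlonglongrightarrow> L z" for z
          by (intro blinfun.tendsto lim tendsto_const)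
        show "(\<lambda>n. cinner (X n x) y) \<longlonglongrightarrow> cinner (L x) y"
          by (intro tendsto_intros ev)
        have "(\<lambda>n. cinner x (X n y)) \<longlonglongrightarrow> cinner x (L y)"
          by (intro tendsto_intros ev)
        then show "(\<lambda>n. cinner (X n x) y) \<longlonglongrightarrow> cinner x (L y)"
          using XS by (simp add: S_def)
      qed
      ultimately show "L \<in> S" by (simp add: S_def)
    qed
    then show "complete S" by (simp add: complete_eq_closed)
    have "0 \<in> S" using r0 by (simp add: S_def)
    then show "S \<noteq> {}" by blast
    show "F ` S \<subseteq> S"
    proof (intro image_subsetI)
      fix Y assume Y: "Y \<in> S"
      have "norm (A + (Y o\<^sub>L Y)) \<le> r * r + r * r"
        using Y r0 by (intro order_trans[OF norm_triangle_ineq] add_mono A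
            order_trans[OF norm_blinfun_compose] mult_mono) (auto simp: S_def)
      then have "norm (F Y) \<le> r * r" by (simp add: F_def)
      also have "\<dots> \<le> r" using r r0 by (simp add: mult_left_le)
      finally show "F Y \<in> S"
        using Y by (simp add: S_def F_def blinfun.add_left blinfun.scaleR_left cinner_add_left
            cinner_add_right cinner_scaleR_left cinner_scaleR_right A_sym)
    qed
    show "dist (F Y) (F Z) \<le> r * dist Y Z" if "Y \<in> S" "Z \<in> S" for Y Z
    proof -
      \<comment> \<open>\<open>Y\<close> and \<open>Z\<close> need not commute, so the difference of
        squares is split as \<open>Y (Y - Z) + (Y - Z) Z\<close>.\<close>
      have "F Y - F Z = (1/2) *\<^sub>R ((Y o\<^sub>L (Y - Z)) + ((Y - Z) o\<^sub>L Z))"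
        by (rule blinfun_eqI)
          (simp add: F_def blinfun.bilinear_simps algebra_simps)
      also have "norm \<dots> \<le> (1/2) * (r * norm (Y - Z) + norm (Y - Z) * r)"
        using that r0 unfolding norm_scaleR
        by (intro mult_mono order_trans[OF norm_triangle_ineq] add_mono
            order_trans[OF norm_blinfun_compose]) (auto simp: S_def)
      finally show ?thesis by (simp add: dist_norm)
    qed
  qed (use r r0 in auto)
  then obtain Y where Y: "Y \<in> S" "F Y = Y" by blast
  have fix_eq: "2 *\<^sub>R Y x = A x + Y (Y x)" for x
  proof -
    have "2 *\<^sub>R Y x = 2 *\<^sub>R F Y x" using Y(2) by simp
    also have "\<dots> = A x + Y (Y x)" by (simp add: F_def blinfun.add_left blinfun.scaleR_left)
    finally show ?thesis .
  qed
  have sym: "cinner (Y x) y = cinner x (Y y)" for x y using Y(1) by (simp add: S_def)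
  show thesis
  proof (rule that[of "id_blinfun - Y"])
    fix h k
    have "cinner ((id_blinfun - Y) h) ((id_blinfun - Y) k)
        = cinner h (k - 2 *\<^sub>R Y k + Y (Y k))"
      by (simp add: blinfun.diff_left cinner_diff_left cinner_diff_right cinner_add_right sym
          scaleR_2)
    also have "\<dots> = cinner h k - cinner h (A k)"
      by (simp add: fix_eq cinner_diff_right)
    finally show "cinner ((id_blinfun - Y) h) ((id_blinfun - Y) k) = cinner h k - cinner (C h) (C k)"
      by (simp add: A_def cinner_adj[OF C])
  qed
qed

text \<open>Every natural number is reached from exactly one even number by iterating
  \<open>n -> 2 * n + 1\<close>. So this is a direct sum of backward shifts, one for each even
  index, and its kernel is the closed span of the even unit vectors. That leaves room in the kernel
  for a copy of the whole space next to \<open>unit_ell2 0\<close>.\<close>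

definition bshift :: "ell2 \<Rightarrow>\<^sub>L ell2" where
  "bshift = pull (\<lambda>n. 2 * n + 1)"

lemma inj_odd: "inj (\<lambda>n :: nat. 2 * n + 1)" by (simp add: inj_def)

lemma clinear_bshift: "clinear_op bshift"
  unfolding bshift_def by (rule clinear_pull[OF inj_odd])

lemma norm_bshift_le: "norm bshift \<le> 1"
  unfolding bshift_def by (rule norm_pull_le[OF inj_odd])

lemma bshift_adj [simp]: "bshift (adj bshift x) = x"
  unfolding bshift_def by (rule pull_adj_pull[OF inj_odd])

lemma bshift_unit_0: "bshift (unit_ell2 0) = 0"
  unfolding bshift_def by (rule ell2_eqI) (simp only: pull_nth[OF inj_odd], simp add: ell2_nth_unit)

lemma norm_adj_bshift [simp]: "norm (adj bshift x) = norm x"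
  unfolding bshift_def by (rule norm_adj_pull[OF inj_odd])

lemma cinner_iter_adj:
  assumes "clinear_op T"
  shows "cinner (iter (adj T) n x) y = cinner x (iter T n y)"
proof (induction n arbitrary: y)
  case (Suc n)
  have "cinner (iter (adj T) (Suc n) x) y = cinner x (iter T n (T y))"
    by (simp add: cinner_adj'[OF assms] Suc)
  then show ?case by (simp add: funpow_swap1)
qed simp

text \<open>With \<open>B = bshift\<close>, the vector \<open>V h\<close> is the sum over
  \<open>n\<close> of \<open>B*^n Q D C^n h\<close>, where \<open>Q\<close> is an isometry into the
  kernel of \<open>B\<close>. Applying \<open>B\<close> drops the first term, which gives the
  intertwining. The squared norms telescope, since
  \<open>|D C^n h|^2 = |C^n h|^2 - |C^(n+1) h|^2\<close> and \<open>C^n h\<close> tends to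
  0.\<close>

lemma bshift_model_exists:
  assumes C: "clinear_op C" and r: "norm C \<le> r" "r < 1"
  obtains V :: "ell2 \<Rightarrow>\<^sub>L ell2"
    where "\<And>h. bshift (V h) = V (C h)" "\<And>h k. cinner (V h) (V k) = cinner h k"
      "\<And>h. cinner (V h) (unit_ell2 0) = 0"
proof -
  have r0: "0 \<le> r" using norm_ge_zero r(1) by (rule order_trans)
  obtain D :: "ell2 \<Rightarrow>\<^sub>L ell2"
    where D: "\<And>h k. cinner (D h) (D k) = cinner h k - cinner (C h) (C k)"
    using defect_operator_exists[OF C r] by blast
  \<comment> \<open>The even indices from 2 on carry the copy of the space; index 0 stays free for
    the wandering vector.\<close>
  have inj_even: "inj (\<lambda>n :: nat. 2 * n + 2)" by (simp add: inj_def)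
  define Q where "Q = adj (pull (\<lambda>n. 2 * n + 2))"
  have BQ: "bshift (Q x) = 0" for x
    unfolding Q_def bshift_def
    by (rule pull_adj_pull_disjoint[OF inj_odd inj_even]) (auto, presburger)
  have QQ: "cinner (Q x) (Q y) = cinner x y" for x y
    unfolding Q_def by (rule cinner_adj_pull_adj_pull[OF inj_even])
  have Qw: "cinner (Q x) (unit_ell2 0) = 0" for x
    unfolding Q_def cinner_unit adj_pull_nth[OF inj_even] by (simp add: image_iff)
  \<comment> \<open>The series solves \<open>V = Q D + B* V C\<close>. As
    \<open>norm C \<le> r < 1\<close>, the fixed point theorem replaces the summation.\<close>
  define F where "F V = (Q o\<^sub>L D) + (adj bshift o\<^sub>L V o\<^sub>L C)" for V
  have "\<exists>!V. F V = V"
  proof (rule banach_fix_type[OF r0 r(2)], intro allI)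
    fix V W
    have "F V - F W = adj bshift o\<^sub>L (V - W) o\<^sub>L C"
      by (rule blinfun_eqI) (simp add: F_def blinfun.bilinear_simps)
    also have "norm \<dots> \<le> norm (V - W) * norm C"
      using norm_adj_le[OF clinear_bshift] norm_bshift_le
      by (intro order_trans[OF norm_blinfun_compose] mult_right_mono
          order_trans[OF norm_blinfun_compose] mult_left_le_one_le) auto
    also have "\<dots> \<le> r * norm (V - W)" using r by (simp add: mult.commute mult_right_mono)
    finally show "dist (F V) (F W) \<le> r * dist V W" by (simp add: dist_norm)
  qed
  then obtain V where "F V = V" by blast
  then have V: "V h = Q (D h) + adj bshift (V (C h))" for h
    by (metis F_def blinfun.add_left blinfun_apply_blinfun_compose)
  have BV: "bshift (V h) = V (C h)" for h
    by (subst V) (simp add: blinfun.add_right BQ)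
  have Vw: "cinner (V h) (unit_ell2 0) = 0" for h
    by (subst V) (simp add: cinner_add_left Qw cinner_adj'[OF clinear_bshift] bshift_unit_0)
  have *: "cinner (Q x) (adj bshift y) = 0" "cinner (adj bshift y) (Q x) = 0" for x y
    by (simp_all add: cinner_adj'[OF clinear_bshift] cinner_adj[OF clinear_bshift, symmetric] BQ)
  \<comment> \<open>The deviation from being isometric is unchanged when \<open>C\<close> is applied
    to both arguments, and along the iterates it tends to its value at zero.\<close>
  define g where "g h k = cinner (V h) (V k) - cinner h k" for h k
  have g_step: "g h k = g (C h) (C k)" for h k
  proof -
    have "cinner (V h) (V k)
        = cinner (Q (D h) + adj bshift (V (C h))) (Q (D k) + adj bshift (V (C k)))"
      by (simp only: V[symmetric])
    also have "\<dots> = cinner (D h) (D k) + cinner (V (C h)) (V (C k))"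
      by (simp add: cinner_add_left cinner_add_right * QQ BQ cinner_adj'[OF clinear_bshift])
    finally show ?thesis by (simp add: g_def D)
  qed
  have g_iter: "g h k = g (iter C n h) (iter C n k)" for h k n
    by (induction n) (simp_all flip: g_step)
  have Cn: "(\<lambda>n. iter C n h) \<longlonglongrightarrow> 0" for h
  proof (rule Lim_null_comparison)
    show "\<forall>\<^sub>F n in sequentially. norm (iter C n h) \<le> r ^ n * norm h"
      using strict_contraction_funpow_norm_le[OF r(1) r0] by simp
    show "(\<lambda>n. r ^ n * norm h) \<longlonglongrightarrow> 0"
      using tendsto_mult[OF LIMSEQ_realpow_zero[OF r0 r(2)] tendsto_const] by simp
  qed
  have "g h k = 0" for h k
  proof (rule LIMSEQ_unique)
    show "(\<lambda>n. g (iter C n h) (iter C n k)) \<longlonglongrightarrow> g h k"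
      by (simp flip: g_iter)
    have "(\<lambda>n. g (iter C n h) (iter C n k)) \<longlonglongrightarrow> cinner (V 0) (V 0) - cinner 0 0"
      unfolding g_def by (intro tendsto_intros Cn blinfun.tendsto)
    then show "(\<lambda>n. g (iter C n h) (iter C n k)) \<longlonglongrightarrow> 0"
      by (simp add: blinfun.zero_right)
  qed
  then have "cinner (V h) (V k) = cinner h k" for h k by (simp add: g_def)
  then show thesis using that BV Vw by blast
qed

section \<open>Powers of the shift and of its adjoint\<close>

lemma iter_bshift_adj_add: "iter bshift (j + m) (iter (adj bshift) m p) = iter bshift j p"
proof (induction m)
  case (Suc m)
  have *: "iter bshift (j + Suc m) q = iter bshift (j + m) (bshift q)" for q
    by (simp add: funpow_swap1)
  show ?case unfolding * by (simp add: Suc)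
qed simp

lemma iter_bshift_adj_le:
  "n \<le> m \<Longrightarrow> iter bshift n (iter (adj bshift) m p) = iter (adj bshift) (m - n) p"
  using iter_bshift_adj_add[of 0 n "iter (adj bshift) (m - n) p"]
  by (simp add: funpow_add[of n "m - n", symmetric, THEN fun_cong, unfolded comp_apply])

lemma iter_bshift_adj_ge:
  "m \<le> n \<Longrightarrow> iter bshift n (iter (adj bshift) m p) = iter bshift (n - m) p"
  using iter_bshift_adj_add[of "n - m" m p] by simp

lemma iter_bshift_unit_0: "n > 0 \<Longrightarrow> iter bshift n (unit_ell2 0) = 0"
  by (cases n) (simp_all add: funpow_Suc_right bshift_unit_0 del: funpow.simps)

lemma norm_iter_adj_bshift [simp]: "norm (iter (adj bshift) n x) = norm x"
  by (induction n) simp_all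

lemma norm_unit_ell2 [simp]: "norm (unit_ell2 k) = 1"
proof -
  have "(norm (unit_ell2 k))\<^sup>2 = 1"
    unfolding norm_ell2_square by (subst suminf_finite[of "{k}"]) (auto simp: ell2_nth_unit)
  then show ?thesis using power2_eq_1_iff[of "norm (unit_ell2 k)"] norm_ge_zero[of "unit_ell2 k"] by linarith
qed

text \<open>If \<open>\<langle>C\<^sup>n x, y\<rangle>\<close> is close to \<open>\<delta>\<^sub>n\<^sub>0\<close> then the error is realised by small vectors for the
  backward shift \<open>B\<close>. Its tail \<open>n \<ge> K\<close> comes from \<open>B\<^sup>*\<^sup>K V C\<^sup>K x\<close> and \<open>V y\<close>, where \<open>V\<close> embeds
  \<open>C\<close> into \<open>B\<close>; rescaling by \<open>t\<close> makes both small because \<open>C\<^sup>K x\<close> is. This also perturbs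
  the finitely many remaining coefficients, by at most \<open>\<parallel>C\<^sup>K x\<parallel> \<parallel>y\<parallel>\<close> each, and
  those are adjusted on the orbit of the wandering vector \<open>w\<close>, which is orthogonal to the range
  of \<open>V\<close>.\<close>

lemma realize_error:
  assumes C: "clinear_op C" and r: "norm C \<le> r" "r < 1" and K: "K \<ge> 1" and d: "d > 0"
    and small: "real K * norm (iter C K x) * (norm y + 1) < d\<^sup>2"
    and sum: "(\<Sum>n<K. cmod (cinner (iter C n x) y - of_bool (n = 0))) < d\<^sup>2"
  obtains u v where "norm u \<le> 3 * d" "norm v \<le> 2 * d"
    "\<And>n. cinner (iter C n x) y + cinner (iter bshift n u) v = of_bool (n = 0)"
proof -
  obtain V :: "ell2 \<Rightarrow>\<^sub>L ell2" where BV: "\<And>h. bshift (V h) = V (C h)"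
    and VV: "\<And>h k. cinner (V h) (V k) = cinner h k"
    and Vw: "\<And>h. cinner (V h) (unit_ell2 0) = 0"
    using bshift_model_exists[OF C r] by blast
  have normV: "norm (V h) = norm h" for h by (rule norm_eq_if_cinner_self_eq) (rule VV)
  have BnV: "iter bshift n (V h) = V (iter C n h)" for n h
    by (induction n) (simp_all add: BV)
  define w where "w = unit_ell2 0"
  have wV: "cinner w (V h) = 0" for h using Vw[of h] by (metis cinner_commute complex_cnj_zero w_def)
  define z where "z = iter C K x"
  \<comment> \<open>\<open>V z\<close> is scaled by \<open>t\<close> and \<open>V y\<close> by
    \<open>1 / t\<close>: the first becomes at most \<open>d\<close> because
    \<open>norm z * (norm y + 1) \<le> d\<^sup>2\<close>, the second because
    \<open>norm y \<le> norm y + 1\<close>. The \<open>+ 1\<close> keeps \<open>t\<close> positive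
    even for \<open>y = 0\<close>.\<close>
  define t where "t = (norm y + 1) / d"
  have t: "t > 0" using d by (auto simp: t_def intro!: divide_pos_pos add_nonneg_pos)
  define e where "e n = cinner (iter C n x) y - of_bool (n = 0)" for n
  \<comment> \<open>Up to sign, the cross term that \<open>B*^K V z\<close> creates in a coefficient
    \<open>n < K\<close>, as \<open>B^n B*^K = B*^(K-n)\<close>.\<close>
  define b where "b n = cinner z (iter C (K - n) y)" for n
  \<comment> \<open>Pairing with \<open>d *\<^sub>R w\<close> multiplies by \<open>d\<close>, so
    coefficient \<open>n\<close> receives \<open>b n - e n\<close>, which cancels both the cross
    term and the error.\<close>
  define a where "a n = (b n - e n) / of_real d" for n
  define u where "u = - (t *\<^sub>R iter (adj bshift) K (V z)) + (\<Sum>m<K. a m *\<^sub>C iter (adj bshift) m w)"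
  define v where "v = (1 / t) *\<^sub>R V y + d *\<^sub>R w"
  have b_le: "cmod (b n) \<le> norm z * norm y" for n
    unfolding b_def using contraction_funpow_norm_le[of C "K - n" y] r
    by (intro order_trans[OF cmod_cinner_le] mult_left_mono) auto
  have p1: "cinner (iter bshift n (iter (adj bshift) K (V z))) v
      = (if n < K then b n else cinner (iter C n x) y) / of_real t" for n
  proof (cases "n < K")
    case True
    then show ?thesis
      by (simp add: iter_bshift_adj_le cinner_iter_adj[OF clinear_bshift] v_def cinner_add_right
          cinner_scaleR_right BnV VV b_def w_def iter_bshift_unit_0 funpow_add_apply
          funpow_scaleR_apply scaleR_conv_of_real divide_simps)
  next
    case False
    then have "iter C (n - K) z = iter C n x"
      unfolding z_def by (metis comp_apply funpow_add le_add_diff_inverse2 not_less)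
    with False show ?thesis
      by (simp add: iter_bshift_adj_ge BnV v_def cinner_add_right cinner_scaleR_right VV Vw w_def
          scaleR_conv_of_real divide_simps)
  qed
  have ww: "cinner w w = 1" by (simp add: w_def cinner_self_norm)
  \<comment> \<open>For \<open>n > m\<close> the shift kills \<open>w\<close>. For
    \<open>n < m\<close> the pairing is that of \<open>w\<close> with \<open>B^(m-n) v\<close>,
    where the \<open>w\<close> part vanishes and the rest lies in the range of \<open>V\<close>,
    orthogonal to \<open>w\<close>.\<close>
  have p2: "cinner (iter bshift n (iter (adj bshift) m w)) v = (if m = n then of_real d else 0)" for n m
  proof (cases "m < n")
    case True
    then show ?thesis by (simp add: iter_bshift_adj_ge iter_bshift_unit_0 w_def)
  next
    case False
    then show ?thesis
      by (cases "m = n")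
        (simp_all add: iter_bshift_adj_le cinner_iter_adj[OF clinear_bshift] v_def cinner_add_right
          cinner_scaleR_right BnV wV ww iter_bshift_unit_0[folded w_def] funpow_add_apply
          funpow_scaleR_apply scaleR_conv_of_real)
  qed
  show thesis
  proof (rule that)
    have K1: "1 \<le> real K" using K by simp
    have "norm z * (norm y + 1) \<le> real K * (norm z * (norm y + 1))"
      using mult_right_mono[OF K1, of "norm z * (norm y + 1)"] by simp
    then have zy: "norm z * (norm y + 1) \<le> d\<^sup>2" using small by (simp add: z_def mult.assoc)
    have "norm (t *\<^sub>R iter (adj bshift) K (V z)) = norm z * (norm y + 1) / d"
      using d by (simp add: normV t_def abs_of_pos add_nonneg_nonneg)
    also have "\<dots> \<le> d" using zy d by (simp add: divide_le_eq power2_eq_square)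
    finally have n1: "norm (t *\<^sub>R iter (adj bshift) K (V z)) \<le> d" .
    have "(\<Sum>m<K. cmod (b m - e m)) \<le> (\<Sum>m<K. norm z * norm y + cmod (e m))"
      by (intro sum_mono order_trans[OF norm_triangle_ineq4] add_mono b_le) auto
    also have "\<dots> = real K * norm z * norm y + (\<Sum>m<K. cmod (e m))"
      by (simp add: sum.distrib)
    also have "real K * norm z * norm y \<le> real K * norm z * (norm y + 1)"
      by (intro mult_left_mono) auto
    finally have "(\<Sum>m<K. cmod (b m - e m)) \<le> 2 * d\<^sup>2"
      using small sum by (simp add: z_def e_def)
    have "norm (\<Sum>m<K. a m *\<^sub>C iter (adj bshift) m w) \<le> (\<Sum>m<K. cmod (b m - e m) / d)"
      using d by (intro sum_norm_le) (simp add: norm_scaleC w_def a_def norm_divide)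
    also have "\<dots> = (\<Sum>m<K. cmod (b m - e m)) / d" by (simp add: sum_divide_distrib)
    also have "\<dots> \<le> 2 * d"
      using d \<open>(\<Sum>m<K. cmod (b m - e m)) \<le> 2 * d\<^sup>2\<close> by (simp add: divide_le_eq power2_eq_square)
    finally have n2: "norm (\<Sum>m<K. a m *\<^sub>C iter (adj bshift) m w) \<le> 2 * d" .
    show "norm u \<le> 3 * d"
      unfolding u_def using n1 n2 norm_triangle_ineq[of "- (t *\<^sub>R iter (adj bshift) K (V z))"
        "\<Sum>m<K. a m *\<^sub>C iter (adj bshift) m w"] by (simp del: norm_scaleR)
    have "norm ((1 / t) *\<^sub>R V y) = norm y * d / (norm y + 1)" using t d by (simp add: normV t_def)
    also have "\<dots> \<le> d" using d by (subst pos_divide_le_eq) (auto simp: algebra_simps add_nonneg_pos add_pos_nonneg)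
    finally have "norm ((1 / t) *\<^sub>R V y) \<le> d" .
    then show "norm v \<le> 2 * d"
      unfolding v_def using norm_triangle_ineq[of "(1 / t) *\<^sub>R V y" "d *\<^sub>R w"] d
      by (simp add: w_def del: norm_scaleR) (simp add: w_def)
    fix n
    have "cinner (iter bshift n u) v = - of_real t * cinner (iter bshift n (iter (adj bshift) K (V z))) v
        + (\<Sum>m<K. a m * cinner (iter bshift n (iter (adj bshift) m w)) v)"
      unfolding u_def
      by (simp add: funpow_add_apply funpow_sum_apply cinner_add_left cinner_sum_left
          funpow_scaleC_apply[OF clinear_bshift] cinner_scaleC_left cinner_scaleR_left
          funpow_scaleR_apply scaleR_conv_of_real flip: scaleR_minus_left)
    also have "\<dots> = - (if n < K then b n else cinner (iter C n x) y)
        + (\<Sum>m<K. if m = n then a m * of_real d else 0)"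
      unfolding p1 p2 using t by (intro arg_cong2[where f = "(+)"] sum.cong) auto
    also have "(\<Sum>m<K. if m = n then a m * of_real d else 0) = (if n < K then a n * of_real d else 0)"
      by simp
    \<comment> \<open>Coefficients with \<open>n \<ge> K\<close> become zero; this is the prescribed
      value because \<open>K \<ge> 1\<close> excludes \<open>n = 0\<close>.\<close>
    finally show "cinner (iter C n x) y + cinner (iter bshift n u) v = of_bool (n = 0)"
      using d K by (auto simp: a_def e_def)
  qed
qed

section \<open>Approximation by a finite section and a shift\<close>

definition tail :: "nat \<Rightarrow> ell2 \<Rightarrow>\<^sub>L ell2" where
  "tail N = pull (\<lambda>n. n + N)"

text \<open>The orthogonal projection onto the first \<open>N\<close> coordinates, written as a
  complement so that its rules follow from \<open>tail_adj\<close>.\<close>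

definition head :: "nat \<Rightarrow> ell2 \<Rightarrow>\<^sub>L ell2" where
  "head N = id_blinfun - (adj (tail N) o\<^sub>L tail N)"

definition compress :: "nat \<Rightarrow> real \<Rightarrow> (ell2 \<Rightarrow>\<^sub>L ell2) \<Rightarrow> ell2 \<Rightarrow>\<^sub>L ell2" where
  "compress N r T = r *\<^sub>R (head N o\<^sub>L T o\<^sub>L head N)"

text \<open>For \<open>r < 1\<close>, the factor inside \<open>compress\<close> makes the first
  block a strict contraction, as the shift model requires; the outer factor makes the whole operator
  strict, so that all orbits decay.\<close>

definition shift_ext :: "nat \<Rightarrow> real \<Rightarrow> (ell2 \<Rightarrow>\<^sub>L ell2) \<Rightarrow> (ell2 \<Rightarrow>\<^sub>L ell2) \<Rightarrow> ell2 \<Rightarrow>\<^sub>L ell2" where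
  "shift_ext N r T S = r *\<^sub>R (compress N r T + (adj (tail N) o\<^sub>L S o\<^sub>L tail N))"

lemma inj_add_right: "inj (\<lambda>n :: nat. n + N)" by (simp add: inj_def)

lemma clinear_tail: "clinear_op (tail N)"
  unfolding tail_def by (rule clinear_pull[OF inj_add_right])

lemma clinear_adj_tail: "clinear_op (adj (tail N))"
  by (rule clinear_op_adj[OF clinear_tail])

lemma tail_adj [simp]: "tail N (adj (tail N) x) = x"
  unfolding tail_def by (rule pull_adj_pull[OF inj_add_right])

lemma norm_adj_tail [simp]: "norm (adj (tail N) x) = norm x"
  unfolding tail_def by (rule norm_adj_pull[OF inj_add_right])

lemma head_apply: "head N x = x - adj (tail N) (tail N x)"
  by (simp add: head_def blinfun.diff_left)

lemma compress_apply: "compress N r T x = r *\<^sub>R head N (T (head N x))"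
  by (simp add: compress_def blinfun.scaleR_left)

lemma shift_ext_apply:
  "shift_ext N r T S x = r *\<^sub>R (compress N r T x + adj (tail N) (S (tail N x)))"
  by (simp add: shift_ext_def blinfun.scaleR_left blinfun.add_left)

lemma tail_head [simp]: "tail N (head N x) = 0"
  by (simp add: head_apply blinfun.diff_right)

lemma head_adj_tail [simp]: "head N (adj (tail N) x) = 0"
  by (simp add: head_apply)

lemma cinner_head_adj_tail [simp]: "cinner (head N x) (adj (tail N) y) = 0"
  "cinner (adj (tail N) y) (head N x) = 0"
  by (simp_all add: cinner_adj[OF clinear_tail, symmetric] cinner_adj'[OF clinear_tail])

lemma cinner_head: "cinner (head N x) y = cinner x (head N y)"
  by (simp add: head_apply cinner_diff_left cinner_diff_right cinner_adj[OF clinear_tail, symmetric]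
      cinner_adj'[OF clinear_tail])

lemma clinear_head: "clinear_op (head N)"
  by (simp add: clinear_op_iff head_apply scaleC_diff_right clinear_op_scaleC[OF clinear_tail]
      clinear_op_scaleC[OF clinear_adj_tail])

lemma norm_head_tail: "(norm x)\<^sup>2 = (norm (head N x))\<^sup>2 + (norm (tail N x))\<^sup>2"
proof -
  have "(norm x)\<^sup>2 = (norm (head N x + adj (tail N) (tail N x)))\<^sup>2" by (simp add: head_apply)
  also have "\<dots> = (norm (head N x))\<^sup>2 + (norm (tail N x))\<^sup>2"
    by (subst norm_sq_add_orthogonal) simp_all
  finally show ?thesis .
qed

lemma norm_head_apply_le: "norm (head N x) \<le> norm x"
  by (rule power2_le_imp_le) (use norm_head_tail[of x N] in simp_all)

lemma norm_head_le: "norm (head N) \<le> 1"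
  by (rule norm_blinfun_bound) (simp_all add: norm_head_apply_le)

lemma clinear_compress: "clinear_op T \<Longrightarrow> clinear_op (compress N r T)"
  by (simp add: clinear_op_iff[of "compress N r T"] compress_apply clinear_op_scaleC[OF clinear_head]
      clinear_op_scaleC scaleR_scaleC complex_vector.scale_left_commute)

lemma clinear_shift_ext: "clinear_op T \<Longrightarrow> clinear_op S \<Longrightarrow> clinear_op (shift_ext N r T S)"
  by (simp add: clinear_op_iff[of "shift_ext N r T S"] shift_ext_apply
      clinear_op_scaleC[OF clinear_compress] clinear_op_scaleC[OF clinear_tail]
      clinear_op_scaleC[OF clinear_adj_tail] clinear_op_scaleC scaleR_scaleC
      complex_vector.scale_left_commute flip: scaleC_add_right)

lemma norm_compress_apply_le:
  assumes "norm T \<le> 1" "0 \<le> r"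
  shows "norm (compress N r T x) \<le> r * norm (head N x)"
  unfolding compress_apply norm_scaleR using assms
  by (auto intro!: mult_left_mono order_trans[OF norm_head_apply_le] contraction_norm_le)

lemma norm_compress_le:
  assumes "norm T \<le> 1" "0 \<le> r"
  shows "norm (compress N r T) \<le> r"
  by (rule norm_blinfun_bound[OF assms(2)], rule order_trans[OF norm_compress_apply_le[OF assms]])
    (intro mult_left_mono norm_head_apply_le assms)

lemma norm_shift_ext_le:
  assumes "norm T \<le> 1" "norm S \<le> 1" "0 \<le> r" "r \<le> 1"
  shows "norm (shift_ext N r T S) \<le> r"
proof (rule norm_blinfun_bound[OF assms(3)])
  fix x
  have "norm (compress N r T x) \<le> 1 * norm (head N x)"
    by (intro order_trans[OF norm_compress_apply_le[OF assms(1,3)]] mult_right_mono assms) auto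
  moreover have "norm (S (tail N x)) \<le> norm (tail N x)" by (rule contraction_norm_le[OF assms(2)])
  moreover have "(norm (compress N r T x + adj (tail N) (S (tail N x))))\<^sup>2
      = (norm (compress N r T x))\<^sup>2 + (norm (S (tail N x)))\<^sup>2"
    by (subst norm_sq_add_orthogonal) (simp_all add: compress_apply cinner_scaleR_left)
  ultimately have "(norm (compress N r T x + adj (tail N) (S (tail N x))))\<^sup>2 \<le> (norm x)\<^sup>2"
    unfolding norm_head_tail[of x N] by (auto intro!: add_mono power_mono)
  then have "norm (compress N r T x + adj (tail N) (S (tail N x))) \<le> norm x"
    by (rule power2_le_imp_le) simp
  then show "norm (shift_ext N r T S x) \<le> r * norm x"
    using assms by (simp add: shift_ext_apply mult_left_mono)
qed

lemma adj_compress: "clinear_op T \<Longrightarrow> adj (compress N r T) = compress N r (adj T)"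
  by (rule adj_eqI[OF clinear_compress])
    (simp_all add: compress_apply cinner_scaleR_left cinner_scaleR_right cinner_head cinner_adj)

lemma adj_shift_ext:
  "clinear_op T \<Longrightarrow> clinear_op S \<Longrightarrow> adj (shift_ext N r T S) = shift_ext N r (adj T) (adj S)"
  by (rule adj_eqI[OF clinear_shift_ext])
    (simp_all add: shift_ext_apply cinner_scaleR_left cinner_scaleR_right cinner_add_left
      cinner_add_right cinner_adj[OF clinear_compress] adj_compress
      cinner_adj[OF clinear_tail, symmetric] cinner_adj'[OF clinear_tail] cinner_adj)

lemma iter_shift_ext:
  "iter (shift_ext N r T S) n (head N x + adj (tail N) u)
    = r ^ n *\<^sub>R (iter (compress N r T) n (head N x) + adj (tail N) (iter S n u))"
proof (induction n)
  case (Suc n)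
  have "tail N (iter (compress N r T) n (head N x)) = 0"
    by (cases n) (simp_all add: compress_apply blinfun.scaleR_right)
  moreover have "compress N r T (adj (tail N) y) = 0" for y
    by (simp add: compress_apply blinfun.zero_right)
  ultimately have "shift_ext N r T S (r ^ n *\<^sub>R (iter (compress N r T) n (head N x) + adj (tail N) (iter S n u)))
      = r ^ Suc n *\<^sub>R (compress N r T (iter (compress N r T) n (head N x)) + adj (tail N) (S (iter S n u)))"
    by (simp add: shift_ext_apply blinfun.add_right blinfun.scaleR_right scaleR_add_right mult.commute)
  then show ?case by (simp only: funpow.simps comp_apply Suc)
qed simp

text \<open>Head and tail evolve separately and stay orthogonal. The factor \<open>r ^ n\<close> is
  harmless for the relation sought: it is 1 at \<open>n = 0\<close>, and the other values are to be
  zero.\<close>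

lemma cinner_iter_shift_ext:
  "cinner (iter (shift_ext N r T S) n (head N x + adj (tail N) u)) (head N y + adj (tail N) v)
    = of_real (r ^ n) * (cinner (iter (compress N r T) n (head N x)) (head N y) + cinner (iter S n u) v)"
proof -
  have "iter (compress N r T) n (head N x) = head N (if n = 0 then x else
      r *\<^sub>R T (head N (iter (compress N r T) (n - 1) (head N x))))"
    by (cases n) (simp_all add: compress_apply blinfun.scaleR_right)
  then have "cinner (iter (compress N r T) n (head N x)) (adj (tail N) v) = 0" by simp
  then show ?thesis
    by (simp add: iter_shift_ext cinner_scaleR_left cinner_add_left cinner_add_right
        scaleR_conv_of_real cinner_adj'[OF clinear_tail] distrib_left)
qed

section \<open>Strong convergence of sections and extensions\<close>

lemma tail_tendsto_0: "(\<lambda>N. tail N x) \<longlonglongrightarrow> 0"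
proof -
  have "(\<lambda>N. \<Sum>n. (cmod (ell2_nth x (n + N)))\<^sup>2) \<longlonglongrightarrow> 0"
    using suminf_exist_split2[OF summable_ell2_nth, of x] .
  then have "(\<lambda>N. (norm (tail N x))\<^sup>2) \<longlonglongrightarrow> 0"
    by (simp add: norm_ell2_square tail_def pull_nth[OF inj_add_right])
  then have "(\<lambda>N. sqrt ((norm (tail N x))\<^sup>2)) \<longlonglongrightarrow> 0"
    using tendsto_real_sqrt[of _ 0] by fastforce
  then show ?thesis by (simp add: tendsto_norm_zero_iff)
qed

lemma head_tendsto: "(\<lambda>N. head N x) \<longlonglongrightarrow> x"
proof -
  have "(\<lambda>N. adj (tail N) (tail N x)) \<longlonglongrightarrow> 0"
    using tail_tendsto_0[of x] by (simp flip: tendsto_norm_zero_iff[of "\<lambda>N. adj (tail N) (tail N x)"] tendsto_norm_zero_iff[of "\<lambda>N. tail N x"])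
  then have "(\<lambda>N. x - adj (tail N) (tail N x)) \<longlonglongrightarrow> x - 0"
    by (intro tendsto_intros)
  then show ?thesis by (simp add: head_apply)
qed

text \<open>The uniform bound makes evaluation jointly continuous: \<open>f i (g i)\<close> and
  \<open>f i z\<close> differ by at most \<open>norm (g i - z)\<close>. By induction, powers of
  contractions then converge strongly too.\<close>

lemma contraction_apply_tendsto:
  fixes f :: "'i \<Rightarrow> ell2 \<Rightarrow>\<^sub>L ell2"
  assumes bd: "\<forall>\<^sub>F i in F. norm (f i) \<le> 1"
    and lim: "((\<lambda>i. f i z) \<longlongrightarrow> w) F" "(g \<longlongrightarrow> z) F"
  shows "((\<lambda>i. f i (g i)) \<longlongrightarrow> w) F"
proof -
  have "((\<lambda>i. f i (g i - z)) \<longlongrightarrow> 0) F"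
  proof (rule Lim_null_comparison)
    show "\<forall>\<^sub>F i in F. norm (f i (g i - z)) \<le> norm (g i - z)"
      using bd by eventually_elim (rule contraction_norm_le)
    show "((\<lambda>i. norm (g i - z)) \<longlongrightarrow> 0) F"
      using lim(2) by (simp add: tendsto_norm_zero LIM_zero)
  qed
  from tendsto_add[OF this lim(1)] show ?thesis by (simp add: blinfun.diff_right)
qed

lemma contraction_iter_tendsto:
  fixes f :: "'i \<Rightarrow> ell2 \<Rightarrow>\<^sub>L ell2" and T :: "ell2 \<Rightarrow>\<^sub>L ell2"
  assumes bd: "\<forall>\<^sub>F i in F. norm (f i) \<le> 1"
    and lim: "\<And>x. ((\<lambda>i. f i x) \<longlongrightarrow> T x) F" and g: "(g \<longlongrightarrow> z) F"
  shows "((\<lambda>i. iter (f i) n (g i)) \<longlongrightarrow> iter T n z) F"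
  by (induction n) (simp_all add: g contraction_apply_tendsto[OF bd lim])

lemma compress_tendsto:
  assumes "r \<longlonglongrightarrow> 1"
  shows "(\<lambda>N. compress N (r N) T x) \<longlonglongrightarrow> T x"
proof -
  have "(\<lambda>N. r N *\<^sub>R head N (T (head N x))) \<longlonglongrightarrow> 1 *\<^sub>R T x"
    by (intro tendsto_intros assms contraction_apply_tendsto[OF _ head_tendsto] blinfun.tendsto
        head_tendsto always_eventually allI norm_head_le)
  then show ?thesis by (simp add: compress_apply)
qed

lemma shift_ext_tendsto:
  assumes r: "r \<longlonglongrightarrow> 1"
  shows "(\<lambda>N. shift_ext N (r N) T S x) \<longlonglongrightarrow> T x"
proof -
  have "(\<lambda>N. adj (tail N) (S (tail N x))) \<longlonglongrightarrow> 0"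
  proof (rule contraction_apply_tendsto)
    have "(\<lambda>N. S (tail N x)) \<longlonglongrightarrow> S 0" by (intro blinfun.tendsto tail_tendsto_0 tendsto_const)
    then show "(\<lambda>N. S (tail N x)) \<longlonglongrightarrow> 0" by (simp add: blinfun.zero_right)
    show "\<forall>\<^sub>F N in sequentially. norm (adj (tail N)) \<le> 1"
      by (intro always_eventually allI norm_blinfun_bound) simp_all
  qed (simp add: blinfun.zero_right)
  then have "(\<lambda>N. r N *\<^sub>R (compress N (r N) T x + adj (tail N) (S (tail N x)))) \<longlonglongrightarrow> 1 *\<^sub>R (T x + 0)"
    by (intro tendsto_intros r compress_tendsto)
  then show ?thesis by (simp add: shift_ext_apply)
qed

section \<open>The strong-star topology\<close>

lemma contractionsD: "T \<in> contractions \<Longrightarrow> clinear_op T" "T \<in> contractions \<Longrightarrow> norm T \<le> 1"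
  by (simp_all add: contractions_def)

lemma continuous_map_SOT_star_apply: "continuous_map SOT_star euclidean (\<lambda>T. blinfun_apply T x)"
proof -
  have "continuous_map (prod_topology strong_operator_topology strong_operator_topology) euclidean
      ((\<lambda>f. blinfun_apply f x) \<circ> (fst :: (ell2 \<Rightarrow>\<^sub>L ell2) \<times> (ell2 \<Rightarrow>\<^sub>L ell2) \<Rightarrow> _))"
    by (rule continuous_map_compose[OF continuous_map_fst strong_operator_topology_continuous_evaluation])
  from continuous_map_pullback[OF this, of contractions "\<lambda>T. (T, adj T)"]
  show ?thesis by (simp add: SOT_star_def comp_def)
qed

lemma tendsto_nhdsin_SOT_star:
  assumes "T \<in> contractions"
  shows "((\<lambda>S. blinfun_apply S x) \<longlongrightarrow> T x) (nhdsin SOT_star T)"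
  unfolding tendsto_def
proof (intro allI impI)
  fix U assume "open U" "T x \<in> U"
  with continuous_map_SOT_star_apply[of x]
  have "openin SOT_star {S \<in> topspace SOT_star. blinfun_apply S x \<in> U}"
    by (intro openin_continuous_map_preimage) auto
  with \<open>T x \<in> U\<close> show "\<forall>\<^sub>F S in nhdsin SOT_star T. blinfun_apply S x \<in> U"
    using assms by (subst eventually_nhdsin)
      (auto simp: topspace_SOT_star intro!: exI[of _ "{S \<in> topspace SOT_star. blinfun_apply S x \<in> U}"])
qed

lemma limitin_strong_operator_topology:
  fixes T :: "'a::real_normed_vector \<Rightarrow>\<^sub>L 'b::real_normed_vector"
  assumes "\<And>x. ((\<lambda>i. blinfun_apply (f i) x) \<longlongrightarrow> T x) F"
  shows "limitin strong_operator_topology f T F"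
  unfolding limitin_def
proof (intro conjI allI impI)
  fix U assume "openin strong_operator_topology U \<and> T \<in> U"
  then obtain W where W: "openin euclidean W" "U = blinfun_apply -` W \<inter> UNIV" "T \<in> U"
    unfolding strong_operator_topology_def openin_pullback_topology by blast
  have "limitin (product_topology (\<lambda>_. euclidean) UNIV) (\<lambda>i. blinfun_apply (f i)) (blinfun_apply T) F"
    unfolding limitin_componentwise using assms by simp
  then have "limitin euclidean (\<lambda>i. blinfun_apply (f i)) (blinfun_apply T) F"
    by (simp only: euclidean_product_topology)
  with W show "\<forall>\<^sub>F i in F. f i \<in> U" unfolding limitin_def by auto
qed (simp add: strong_operator_topology_topspace)

lemma limitin_SOT_star:
  fixes f :: "'i \<Rightarrow> ell2 \<Rightarrow>\<^sub>L ell2" and T :: "ell2 \<Rightarrow>\<^sub>L ell2"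
  assumes "\<And>i. f i \<in> contractions" "T \<in> contractions"
    and "\<And>x. ((\<lambda>i. f i x) \<longlongrightarrow> T x) F" "\<And>x. ((\<lambda>i. adj (f i) x) \<longlongrightarrow> adj T x) F"
  shows "limitin SOT_star f T F"
  unfolding limitin_def
proof (intro conjI allI impI)
  fix U assume "openin SOT_star U \<and> T \<in> U"
  then obtain W where W: "openin (prod_topology strong_operator_topology strong_operator_topology) W"
    "U = (\<lambda>T. (T, adj T)) -` W \<inter> contractions" "T \<in> U"
    unfolding SOT_star_def openin_pullback_topology by blast
  have "limitin (prod_topology strong_operator_topology strong_operator_topology)
      (\<lambda>i. (f i, adj (f i))) (T, adj T) F"
    unfolding limitin_pairwise using assms
    by (auto simp: comp_def intro!: limitin_strong_operator_topology)
  with W assms show "\<forall>\<^sub>F i in F. f i \<in> U" unfolding limitin_def by auto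
qed (simp add: topspace_SOT_star assms)

section \<open>Approximately biorthogonal pairs\<close>

text \<open>Only finitely many orbit vectors enter, which makes the condition open; beyond
  \<open>K\<close> a contraction keeps the orbit small. The factor \<open>K\<close> pays for the
  \<open>K\<close> cross terms in \<open>realize_error\<close>, and the square for the division by
  \<open>d\<close> there, which leaves perturbations of order \<open>d\<close>.\<close>

definition good :: "real \<Rightarrow> (ell2 \<Rightarrow>\<^sub>L ell2) \<Rightarrow> ell2 \<Rightarrow> ell2 \<Rightarrow> bool" where
  "good d T x y \<longleftrightarrow> (\<exists>K\<ge>1. real K * norm (iter T K x) * (norm y + 1) < d\<^sup>2 \<and>
     (\<Sum>n<K. cmod (cinner (iter T n x) y - of_bool (n = 0))) < d\<^sup>2)"

lemma good_witness_eventually: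
  fixes f :: "'i \<Rightarrow> ell2 \<Rightarrow>\<^sub>L ell2" and T :: "ell2 \<Rightarrow>\<^sub>L ell2"
  assumes "\<forall>\<^sub>F i in F. norm (f i) \<le> 1" "\<And>z. ((\<lambda>i. f i z) \<longlongrightarrow> T z) F"
    and "(g \<longlongrightarrow> x) F" "(h \<longlongrightarrow> y) F"
    and "real K * norm (iter T K x) * (norm y + 1) < c"
    and "(\<Sum>n<K. cmod (cinner (iter T n x) y - of_bool (n = 0))) < c"
  shows "\<forall>\<^sub>F i in F. real K * norm (iter (f i) K (g i)) * (norm (h i) + 1) < c \<and>
     (\<Sum>n<K. cmod (cinner (iter (f i) n (g i)) (h i) - of_bool (n = 0))) < c"
proof -
  note it = contraction_iter_tendsto[OF assms(1,2,3)]
  have "((\<lambda>i. real K * norm (iter (f i) K (g i)) * (norm (h i) + 1))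
      \<longlongrightarrow> real K * norm (iter T K x) * (norm y + 1)) F"
    by (intro tendsto_intros it assms)
  moreover have "((\<lambda>i. \<Sum>n<K. cmod (cinner (iter (f i) n (g i)) (h i) - of_bool (n = 0)))
      \<longlongrightarrow> (\<Sum>n<K. cmod (cinner (iter T n x) y - of_bool (n = 0)))) F"
    by (intro tendsto_intros it assms)
  ultimately show ?thesis
    using assms(5,6) by (intro eventually_conj) (auto dest: order_tendstoD(2))
qed

lemma good_eventually:
  fixes f :: "'i \<Rightarrow> ell2 \<Rightarrow>\<^sub>L ell2" and T :: "ell2 \<Rightarrow>\<^sub>L ell2"
  assumes "\<forall>\<^sub>F i in F. norm (f i) \<le> 1" "\<And>z. ((\<lambda>i. f i z) \<longlongrightarrow> T z) F"
    and "(g \<longlongrightarrow> x) F" "(h \<longlongrightarrow> y) F" "good d T x y"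
  shows "\<forall>\<^sub>F i in F. good d (f i) (g i) (h i)"
proof -
  obtain K where K: "K \<ge> 1" "real K * norm (iter T K x) * (norm y + 1) < d\<^sup>2"
     "(\<Sum>n<K. cmod (cinner (iter T n x) y - of_bool (n = 0))) < d\<^sup>2"
    using assms(5) unfolding good_def by blast
  from good_witness_eventually[OF assms(1-4) K(2,3)] show ?thesis
    by eventually_elim (use K(1) in \<open>auto simp: good_def\<close>)
qed

text \<open>The neighbourhood filter of \<open>T\<close> is fed into \<open>good_eventually\<close>,
  so no metric for the topology is required.\<close>

lemma openin_good: "openin SOT_star {T \<in> contractions. good d T x y}"
proof (subst openin_subopen, intro ballI)
  fix T assume "T \<in> {T \<in> contractions. good d T x y}"
  then have T: "T \<in> contractions" "good d T x y" by auto
  have "\<forall>\<^sub>F S in nhdsin SOT_star T. S \<in> contractions"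
    using T by (subst eventually_nhdsin)
      (auto simp: topspace_SOT_star intro!: exI[of _ contractions] openin_topspace[of SOT_star, unfolded topspace_SOT_star])
  moreover from this have "\<forall>\<^sub>F S in nhdsin SOT_star T. norm S \<le> 1"
    by eventually_elim (simp add: contractions_def)
  then have "\<forall>\<^sub>F S in nhdsin SOT_star T. good d S x y"
    using tendsto_nhdsin_SOT_star[OF T(1)] tendsto_const tendsto_const T(2) by (rule good_eventually)
  ultimately have "\<forall>\<^sub>F S in nhdsin SOT_star T. S \<in> {T \<in> contractions. good d T x y}"
    by eventually_elim simp
  then show "\<exists>U. openin SOT_star U \<and> T \<in> U \<and> U \<subseteq> {T \<in> contractions. good d T x y}"
    using T by (subst (asm) eventually_nhdsin) (auto simp: topspace_SOT_star)
qed

text \<open>Since \<open>K * r ^ K\<close> tends to 0, an exact relation for a strict contraction is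
  good at every precision.\<close>

lemma good_if_strict_contraction:
  assumes r: "norm T \<le> r" "r < 1" and d: "d > 0"
    and xy: "\<And>n. cinner (iter T n x) y = of_bool (n = 0)"
  shows "good d T x y"
proof -
  have r0: "0 \<le> r" using norm_ge_zero r(1) by (rule order_trans)
  have "(\<lambda>n. real n * r ^ n * (norm x * (norm y + 1))) \<longlonglongrightarrow> 0"
    using tendsto_mult[OF powser_times_n_limit_0[of r] tendsto_const] r r0 by simp
  then have "\<forall>\<^sub>F n in sequentially. real n * r ^ n * (norm x * (norm y + 1)) < d\<^sup>2"
    by (rule order_tendstoD) (use d in simp)
  then obtain K where K: "K \<ge> 1" "real K * r ^ K * (norm x * (norm y + 1)) < d\<^sup>2"
    using eventually_conj[OF _ eventually_ge_at_top[of 1]] eventually_happens[of _ sequentially] by force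
  have "real K * norm (iter T K x) * (norm y + 1) \<le> real K * (r ^ K * norm x) * (norm y + 1)"
    by (intro mult_right_mono mult_left_mono strict_contraction_funpow_norm_le r r0) auto
  also have "\<dots> < d\<^sup>2" using K(2) by (simp add: mult.assoc)
  finally show ?thesis
    unfolding good_def xy using K(1) d by (intro exI[of _ K]) simp
qed

text \<open>The relation holds exactly for the strict contraction \<open>f N\<close> and the moved
  pair. Hence the distance moved is governed by \<open>d\<close> alone, while the new precision
  \<open>d'\<close> is arbitrary and one sequence serves them all.\<close>

lemma good_perturbation:
  assumes R: "R \<in> contractions" and good: "good d R x y" and d: "d > 0"
  obtains f where "\<And>N. f N \<in> contractions" "limitin SOT_star f R sequentially"
    "\<And>d'. d' > 0 \<Longrightarrow> \<forall>\<^sub>F N in sequentially.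
      \<exists>x' y'. norm (x' - x) < 4 * d \<and> norm (y' - y) < 4 * d \<and> good d' (f N) x' y'"
proof -
  \<comment> \<open>One index drives both limits: the sections grow while \<open>r N\<close> tends
    to 1 from below.\<close>
  define r where "r N = 1 - inverse (real (Suc N))" for N
  have r01: "0 \<le> r N" "r N < 1" for N by (auto simp: r_def inverse_le_1_iff)
  have r_lim: "r \<longlonglongrightarrow> 1"
    using tendsto_diff[OF tendsto_const LIMSEQ_inverse_real_of_nat, of 1] by (simp add: r_def[abs_def])
  note clinR = contractionsD(1)[OF R] and normR = contractionsD(2)[OF R]
  define f where "f N = shift_ext N (r N) R bshift" for N
  define C where "C N = compress N (r N) R" for N
  have f_norm: "norm (f N) \<le> r N" for N
    unfolding f_def using r01[of N] normR norm_bshift_le by (intro norm_shift_ext_le) auto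
  have fc: "f N \<in> contractions" for N
    using f_norm[of N] r01[of N] clinear_shift_ext[OF clinR clinear_bshift, of N "r N"]
    by (simp add: contractions_def f_def)
  have lim: "limitin SOT_star f R sequentially"
    by (rule limitin_SOT_star[OF fc R])
      (unfold f_def adj_shift_ext[OF clinR clinear_bshift], (rule shift_ext_tendsto[OF r_lim])+)
  obtain K where K: "K \<ge> 1" "real K * norm (iter R K x) * (norm y + 1) < d\<^sup>2"
     "(\<Sum>n<K. cmod (cinner (iter R n x) y - of_bool (n = 0))) < d\<^sup>2"
    using good unfolding good_def by blast
  have C: "clinear_op (C N)" "norm (C N) \<le> r N" for N
    unfolding C_def using clinear_compress[OF clinR] norm_compress_le[OF normR r01(1)] by auto
  have "norm (C N) \<le> 1" for N using C(2)[of N] r01[of N] by linarith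
  then have ev1: "\<forall>\<^sub>F N in sequentially.
      real K * norm (iter (C N) K (head N x)) * (norm (head N y) + 1) < d\<^sup>2 \<and>
      (\<Sum>n<K. cmod (cinner (iter (C N) n (head N x)) (head N y) - of_bool (n = 0))) < d\<^sup>2"
    unfolding C_def
    by (intro good_witness_eventually[OF _ compress_tendsto[OF r_lim] head_tendsto head_tendsto K(2,3)]
        always_eventually) auto
  have hd: "\<forall>\<^sub>F N in sequentially. norm (head N z - z) < d" for z
    using tendstoD[OF head_tendsto[of z] d] by (simp add: dist_norm)
  have ev: "\<forall>\<^sub>F N in sequentially.
      (real K * norm (iter (C N) K (head N x)) * (norm (head N y) + 1) < d\<^sup>2 \<and>
      (\<Sum>n<K. cmod (cinner (iter (C N) n (head N x)) (head N y) - of_bool (n = 0))) < d\<^sup>2) \<and>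
      norm (head N x - x) < d \<and> norm (head N y - y) < d"
    using ev1 hd[of x] hd[of y] by eventually_elim blast
  \<comment> \<open>Truncation moves a vector by less than \<open>d\<close> and the tail component
    adds at most \<open>3 * d\<close>, whence the constant 4.\<close>
  have near: "norm (head N z + adj (tail N) u - z) < 4 * d" if "norm (head N z - z) < d" "norm u \<le> 3 * d"
    for N z u
    using that norm_triangle_ineq[of "head N z - z" "adj (tail N) u"] by (simp add: algebra_simps)
  show thesis
  proof (rule that[OF fc lim])
    fix d' :: real assume d': "d' > 0"
    show "\<forall>\<^sub>F N in sequentially.
        \<exists>x' y'. norm (x' - x) < 4 * d \<and> norm (y' - y) < 4 * d \<and> good d' (f N) x' y'"
      using ev
    proof eventually_elim
      case (elim N)
      obtain u v where uv: "norm u \<le> 3 * d" "norm v \<le> 2 * d"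
        "\<And>n. cinner (iter (C N) n (head N x)) (head N y) + cinner (iter bshift n u) v = of_bool (n = 0)"
        using realize_error[OF C[of N] r01(2)[of N] K(1) d conjunct1[OF conjunct1[OF elim]] conjunct2[OF conjunct1[OF elim]]] by blast
      have "good d' (f N) (head N x + adj (tail N) u) (head N y + adj (tail N) v)"
      proof (rule good_if_strict_contraction[OF f_norm r01(2) d'])
        show "cinner (iter (f N) n (head N x + adj (tail N) u)) (head N y + adj (tail N) v)
            = of_bool (n = 0)" for n
          unfolding f_def cinner_iter_shift_ext using uv(3)[of n] by (cases n) (simp_all add: C_def)
      qed
      moreover have "norm v \<le> 3 * d" using uv(2) d by simp
      ultimately show ?case using near elim uv(1) by blast
    qed
  qed
qed

section \<open>Baire category\<close>

text \<open>Finite combinations of unit vectors with coefficients in a countable dense set of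
  scalars are dense. The vector \<open>0\<close> is included as the start of the iteration in
  \<open>biorthogonal_if_improvable\<close>.\<close>

lemma ell2_countable_dense: obtains D :: "ell2 set" where "countable D" "0 \<in> D" "closure D = UNIV"
proof -
  obtain Q :: "complex set" where Q: "countable Q" "\<And>X. open X \<Longrightarrow> X \<noteq> {} \<Longrightarrow> \<exists>q\<in>Q. q \<in> X"
    using countable_dense_exists by blast
  define E where "E l = (\<Sum>k<length l. (l ! k) *\<^sub>C unit_ell2 k)" for l
  have "x \<in> closure (E ` lists Q)" for x
  proof (subst closure_approachable, intro allI impI)
    fix e :: real assume e: "e > 0"
    obtain N where N: "dist (\<Sum>k<N. ell2_nth x k *\<^sub>C unit_ell2 k) x < e / 2"
      using metric_LIMSEQ_D[OF unit_sum_tendsto[of x], of "e / 2"] e by auto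
    \<comment> \<open>Half of \<open>e\<close> is shared among \<open>N\<close> coordinates; the
      \<open>+ 1\<close> keeps the radius positive for \<open>N = 0\<close>.\<close>
    have "\<exists>q\<in>Q. q \<in> ball (ell2_nth x k) (e / (2 * (real N + 1)))" for k
      using e by (intro Q(2)) (auto simp: ball_eq_empty not_le divide_pos_pos add_nonneg_pos)
    then obtain q where q: "\<And>k. q k \<in> Q" "\<And>k. dist (ell2_nth x k) (q k) < e / (2 * (real N + 1))"
      by (metis mem_ball)
    define l where "l = map q [0..<N]"
    have "E l - (\<Sum>k<N. ell2_nth x k *\<^sub>C unit_ell2 k) = (\<Sum>k<N. (q k - ell2_nth x k) *\<^sub>C unit_ell2 k)"
      by (simp add: E_def l_def complex_vector.scale_left_diff_distrib sum_subtractf)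
    also have "norm \<dots> \<le> (\<Sum>k<N. e / (2 * (real N + 1)))"
      using q(2) by (intro sum_norm_le) (simp add: norm_scaleC dist_norm norm_minus_commute less_imp_le)
    also have "\<dots> \<le> e / 2" using e by (simp add: field_simps)
    finally have "dist (E l) (\<Sum>k<N. ell2_nth x k *\<^sub>C unit_ell2 k) \<le> e / 2" by (simp add: dist_norm)
    with N have "dist (E l) x < e"
      using dist_triangle[of "E l" x "\<Sum>k<N. ell2_nth x k *\<^sub>C unit_ell2 k"] by simp
    moreover have "l \<in> lists Q" using q(1) by (auto simp: l_def)
    ultimately show "\<exists>z\<in>E ` lists Q. dist z x < e" by blast
  qed
  then have "closure (insert 0 (E ` lists Q)) = UNIV"
    using closure_mono[of "E ` lists Q" "insert 0 (E ` lists Q)"] by blast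
  then show thesis using that[of "insert 0 (E ` lists Q)"] Q(1) by auto
qed

section \<open>Nowhere dense sets and improvable pairs\<close>

lemma nowhere_dense_in_mono:
  assumes A: "nowhere_dense_in X A" and BA: "B \<subseteq> A" shows "nowhere_dense_in X B"
proof -
  have "X interior_of (X closure_of B) \<subseteq> X interior_of (X closure_of A)"
    by (intro interior_of_mono closure_of_mono BA)
  then show ?thesis using A BA unfolding nowhere_dense_in_def by auto
qed

text \<open>\<open>A - U\<close> lies in the boundary of \<open>U\<close>, which is closed. An open
  subset of the boundary misses \<open>U\<close>, hence also the closure of \<open>U\<close>, and so
  is empty.\<close>

lemma nowhere_dense_in_closure_Diff:
  assumes U: "openin X U" and A: "A \<subseteq> X closure_of U"
  shows "nowhere_dense_in X (A - U)"
proof -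
  define C where "C = X closure_of U - U"
  have "closedin X C" using U by (auto simp: C_def intro: closedin_diff)
  then have closure_C: "X closure_of C = C" by (rule closure_of_closedin)
  have sub: "X interior_of C \<subseteq> C" by (rule interior_of_subset)
  then have "X interior_of C \<inter> U = {}" by (auto simp: C_def)
  then have "X interior_of C \<inter> X closure_of U = {}"
    by (simp add: openin_Int_closure_of_eq_empty[OF openin_interior_of])
  with sub have "X interior_of C = {}" by (auto simp: C_def)
  then have "nowhere_dense_in X C"
    unfolding nowhere_dense_in_def closure_C using closedin_subset[OF \<open>closedin X C\<close>] by simp
  then show ?thesis by (rule nowhere_dense_in_mono) (use A in \<open>auto simp: C_def\<close>)
qed

text \<open>The new pair is taken from \<open>D\<close> again, so that the next stage also starts in
  \<open>D\<close> and a countable \<open>D\<close> yields countably many conditions.\<close>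

definition improvable :: "ell2 set \<Rightarrow> real \<Rightarrow> real \<Rightarrow> ell2 \<Rightarrow> ell2 \<Rightarrow> (ell2 \<Rightarrow>\<^sub>L ell2) set" where
  "improvable D d d' x y = {T \<in> contractions.
     \<exists>x'\<in>D. \<exists>y'\<in>D. norm (x' - x) < 4 * d \<and> norm (y' - y) < 4 * d \<and> good d' T x' y'}"

lemma openin_improvable: "openin SOT_star (improvable D d d' x y)"
proof -
  have "improvable D d d' x y = (\<Union>(x', y') \<in> {(x', y'). x' \<in> D \<and> y' \<in> D \<and>
      norm (x' - x) < 4 * d \<and> norm (y' - y) < 4 * d}. {T \<in> contractions. good d' T x' y'})"
    by (auto simp: improvable_def)
  then show ?thesis by (auto intro: openin_good)
qed

text \<open>Both distance bounds are strict and \<open>good\<close> is stable under small changes of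
  the pair, so a witness can be moved into the dense set \<open>D\<close>.\<close>

lemma improvable_iff:
  assumes D: "closure D = UNIV" and T: "T \<in> contractions"
  shows "T \<in> improvable D d d' x y \<longleftrightarrow>
    (\<exists>x' y'. norm (x' - x) < 4 * d \<and> norm (y' - y) < 4 * d \<and> good d' T x' y')"
proof
  assume "\<exists>x' y'. norm (x' - x) < 4 * d \<and> norm (y' - y) < 4 * d \<and> good d' T x' y'"
  then obtain x' y' where *: "norm (x' - x) < 4 * d" "norm (y' - y) < 4 * d" "good d' T x' y'" by blast
  have "\<exists>g. (\<forall>n. g n \<in> D) \<and> g \<longlonglongrightarrow> z" for z
    using D closure_sequential[of z D] by simp
  then obtain g h where gh: "\<And>n. g n \<in> D" "g \<longlonglongrightarrow> x'" "\<And>n. h n \<in> D" "h \<longlonglongrightarrow> y'" by metis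
  have "(\<lambda>n. norm (g n - x)) \<longlonglongrightarrow> norm (x' - x)" "(\<lambda>n. norm (h n - y)) \<longlonglongrightarrow> norm (y' - y)"
    by (intro tendsto_intros gh)+
  then have "\<forall>\<^sub>F n in sequentially. norm (g n - x) < 4 * d" "\<forall>\<^sub>F n in sequentially. norm (h n - y) < 4 * d"
    using * by (auto dest: order_tendstoD(2))
  moreover have "\<forall>\<^sub>F n in sequentially. good d' T (g n) (h n)"
    using contractionsD(2)[OF T] by (intro good_eventually[OF _ tendsto_const gh(2,4) *(3)]) simp
  ultimately have "\<forall>\<^sub>F n in sequentially. norm (g n - x) < 4 * d \<and> norm (h n - y) < 4 * d \<and> good d' T (g n) (h n)"
    by eventually_elim simp
  then obtain n where "norm (g n - x) < 4 * d \<and> norm (h n - y) < 4 * d \<and> good d' T (g n) (h n)"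
    using eventually_happens' sequentially_bot by blast
  then show "T \<in> improvable D d d' x y"
    using T gh(1,3) unfolding improvable_def by blast
qed (auto simp: improvable_def)

lemma good_subset_closure_improvable:
  assumes D: "closure D = UNIV" and d: "d > 0" "d' > 0"
  shows "{T \<in> contractions. good d T x y} \<subseteq> SOT_star closure_of improvable D d d' x y"
proof
  fix R assume "R \<in> {T \<in> contractions. good d T x y}"
  then have R: "R \<in> contractions" "good d R x y" by auto
  obtain f where f: "\<And>N. f N \<in> contractions" "limitin SOT_star f R sequentially"
    "\<And>d'. d' > 0 \<Longrightarrow> \<forall>\<^sub>F N in sequentially.
      \<exists>x' y'. norm (x' - x) < 4 * d \<and> norm (y' - y) < 4 * d \<and> good d' (f N) x' y'"
    by (rule good_perturbation[OF R d(1)]) (rule that; simp)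
  have ev: "\<forall>\<^sub>F N in sequentially. f N \<in> improvable D d d' x y"
    using f(3)[OF d(2)] unfolding improvable_iff[OF D f(1)] .
  have sub: "improvable D d d' x y \<subseteq> SOT_star closure_of improvable D d d' x y"
    by (rule closure_of_subset) (auto simp: improvable_def topspace_SOT_star)
  have "\<forall>\<^sub>F N in sequentially. f N \<in> SOT_star closure_of improvable D d d' x y"
    using ev by eventually_elim (rule subsetD[OF sub])
  then show "R \<in> SOT_star closure_of improvable D d d' x y"
    by (intro limitin_closedin[OF f(2)]) auto
qed

text \<open>Successive improvements halve the precision and move the pair by less than
  \<open>4 * (2 / 2 ^ k) = 8 / 2 ^ k\<close>. The moves are summable, so the pairs converge, and the
  relation becomes exact in the limit.\<close>

lemma biorthogonal_if_improvable:
  fixes T :: "ell2 \<Rightarrow>\<^sub>L ell2"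
  assumes T: "T \<in> contractions" and D: "0 \<in> D"
    and step: "\<And>k x y. x \<in> D \<Longrightarrow> y \<in> D \<Longrightarrow> good (2 / 2 ^ k) T x y
      \<Longrightarrow> T \<in> improvable D (2 / 2 ^ k) (2 / 2 ^ Suc k) x y"
  obtains x y where "\<And>n. cinner (iter T n x) y = of_bool (n = 0)"
proof -
  define P where "P k p \<longleftrightarrow> fst p \<in> D \<and> snd p \<in> D \<and> good (2 / 2 ^ k) T (fst p) (snd p)"
    for k :: nat and p
  define R where "R k p p' \<longleftrightarrow> norm (fst p' - fst p) < 8 / 2 ^ k \<and> norm (snd p' - snd p) < 8 / 2 ^ k"
    for k :: nat and p p' :: "ell2 \<times> ell2"
  have "\<exists>f. \<forall>k. P k (f k) \<and> R k (f k) (f (Suc k))"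
  proof (rule dependent_nat_choice)
    \<comment> \<open>The zero pair has error 1 at \<open>n = 0\<close>, less than
      \<open>2\<^sup>2\<close> but not less than \<open>1\<^sup>2\<close>; therefore the precisions
      start at 2.\<close>
    have "good 2 T 0 0"
      unfolding good_def by (intro exI[of _ 1]) simp
    then show "\<exists>p. P 0 p" using D by (auto simp: P_def intro!: exI[of _ "(0, 0)"])
    show "\<exists>q. P (Suc k) q \<and> R k p q" if "P k p" for p k
      using step[of "fst p" "snd p" k] that
      by (auto simp: P_def R_def improvable_def simp del: power_Suc)
  qed
  then obtain f where f: "\<And>k. P k (f k)" "\<And>k. R k (f k) (f (Suc k))" by blast
  have conv: "convergent g" if "\<And>k. norm (g (Suc k) - g k) < 8 / 2 ^ k" for g :: "nat \<Rightarrow> ell2"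
  proof -
    have "summable (\<lambda>k. g (Suc k) - g k)"
    proof (rule summable_comparison_test')
      show "summable (\<lambda>k. 8 * (1 / 2 :: real) ^ k)" by (intro summable_mult summable_geometric) simp
      show "norm (g (Suc k) - g k) \<le> 8 * (1 / 2) ^ k" for k
        using that[of k] by (simp add: power_one_over field_simps)
    qed
    then have "convergent (\<lambda>n. \<Sum>k<n. g (Suc k) - g k)" by (simp add: summable_iff_convergent)
    then have "convergent (\<lambda>n. (g n - g 0) + g 0)"
      by (intro convergent_add convergent_const) (simp add: sum_lessThan_telescope)
    then show ?thesis by simp
  qed
  obtain x y where lim: "(\<lambda>k. fst (f k)) \<longlonglongrightarrow> x" "(\<lambda>k. snd (f k)) \<longlonglongrightarrow> y"
    using conv[of "\<lambda>k. fst (f k)"] conv[of "\<lambda>k. snd (f k)"] f(2) by (auto simp: R_def convergent_def)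
  \<comment> \<open>Below \<open>K\<close> the coefficient error is a summand of the bounded sum;
    from \<open>K\<close> on the contraction property bounds the coefficient by
    \<open>norm (iter T K x) * norm y\<close> for the current pair.\<close>
  have close: "cmod (cinner (iter T n (fst (f k))) (snd (f k)) - of_bool (n = 0)) \<le> (2 / 2 ^ k)\<^sup>2" for n k
  proof -
    obtain K where K: "K \<ge> 1" "real K * norm (iter T K (fst (f k))) * (norm (snd (f k)) + 1) < (2 / 2 ^ k)\<^sup>2"
      "(\<Sum>n<K. cmod (cinner (iter T n (fst (f k))) (snd (f k)) - of_bool (n = 0))) < (2 / 2 ^ k)\<^sup>2"
      using f(1)[of k] unfolding P_def good_def by blast
    show ?thesis
    proof (cases "n < K")
      case True
      then have "cmod (cinner (iter T n (fst (f k))) (snd (f k)) - of_bool (n = 0))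
          \<le> (\<Sum>n<K. cmod (cinner (iter T n (fst (f k))) (snd (f k)) - of_bool (n = 0)))"
        by (intro member_le_sum) auto
      with K show ?thesis by linarith
    next
      case False
      have "cmod (cinner (iter T n (fst (f k))) (snd (f k))) \<le> norm (iter T n (fst (f k))) * norm (snd (f k))"
        by (rule cmod_cinner_le)
      also have "\<dots> = norm (iter T (n - K) (iter T K (fst (f k)))) * norm (snd (f k))"
        using False by (metis comp_apply funpow_add le_add_diff_inverse2 not_less)
      also have "\<dots> \<le> norm (iter T K (fst (f k))) * (norm (snd (f k)) + 1)"
        by (intro mult_mono contraction_funpow_norm_le contractionsD(2)[OF T]) auto
      also have "\<dots> \<le> real K * (norm (iter T K (fst (f k))) * (norm (snd (f k)) + 1))"
        using mult_right_mono[of 1 "real K" "norm (iter T K (fst (f k))) * (norm (snd (f k)) + 1)"] K(1)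
        by simp
      finally show ?thesis using K False by (simp add: mult.assoc)
    qed
  qed
  have "cinner (iter T n x) y - of_bool (n = 0) = 0" for n
  proof (rule LIMSEQ_unique)
    show "(\<lambda>k. cinner (iter T n (fst (f k))) (snd (f k)) - of_bool (n = 0))
        \<longlonglongrightarrow> cinner (iter T n x) y - of_bool (n = 0)"
      using contractionsD(2)[OF T]
      by (intro tendsto_intros lim contraction_iter_tendsto[of "\<lambda>_. T"]) auto
    show "(\<lambda>k. cinner (iter T n (fst (f k))) (snd (f k)) - of_bool (n = 0)) \<longlonglongrightarrow> 0"
    proof (rule Lim_null_comparison[OF always_eventually, rule_format, OF close])
      have "(\<lambda>k. (2 * (1 / 2) ^ k)\<^sup>2 :: real) \<longlonglongrightarrow> (2 * 0)\<^sup>2"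
        by (intro tendsto_intros LIMSEQ_realpow_zero) auto
      then show "(\<lambda>k. (2 / 2 ^ k)\<^sup>2 :: real) \<longlonglongrightarrow> 0" by (simp add: power_one_over)
    qed
  qed
  then have "cinner (iter T n x) y = of_bool (n = 0)" for n by simp
  then show thesis using that by blast
qed

section \<open>Invariant subspaces\<close>

lemma invariant_subspace_if_biorthogonal:
  fixes T :: "ell2 \<Rightarrow>\<^sub>L ell2"
  assumes T: "clinear_op T" and xy: "\<And>n. cinner (iter T n x) y = of_bool (n = 0)"
  shows "\<exists>E. nontrivial_invariant_subspace T E"
proof -
  define E where "E = {z. \<forall>n. cinner (iter T n z) y = 0}"
  have E: "complex_vector.subspace E" "blinfun_apply T ` E \<subseteq> E"
    unfolding E_def complex_vector.subspace_def
    by (auto simp: funpow_add_apply cinner_add_left funpow_scaleC_apply[OF T] cinner_scaleC_left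
        simp del: funpow.simps) (metis comp_apply funpow_Suc_right)
  have "continuous_on UNIV (\<lambda>z. cinner (iter T n z) y)" for n
  proof -
    have "continuous_on UNIV (iter T n)"
      by (induction n) (auto simp: comp_def intro: blinfun.continuous_on)
    then show ?thesis
      using bounded_linear.continuous_on[OF bounded_linear_cinner_left] by blast
  qed
  then have clE: "closed E" unfolding E_def by (intro closed_Collect_all closed_Collect_eq) auto
  have "x \<notin> E" using xy[of 0] by (auto simp: E_def intro!: exI[of _ 0])
  then have EU: "E \<noteq> UNIV" by blast
  consider "E \<noteq> {0}" | "E = {0}" "T = 0" | "E = {0}" "T \<noteq> 0" by blast
  then show ?thesis
  proof cases
    case 1
    with E clE EU show ?thesis by (auto simp: nontrivial_invariant_subspace_def)
  next
    case 2
    \<comment> \<open>For \<open>T = 0\<close> the kernel is the whole space, but every closed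
      subspace is invariant; a hyperplane is chosen.\<close>
    let ?H = "{z. cinner z (unit_ell2 0) = 0}"
    have "unit_ell2 1 \<in> ?H" "unit_ell2 0 \<notin> ?H"
      by (auto simp: cinner_unit ell2_nth_unit)
    moreover have "unit_ell2 1 \<noteq> 0" by (metis norm_unit_ell2 norm_zero zero_neq_one)
    moreover have "closed ?H"
      by (intro closed_Collect_eq bounded_linear.continuous_on[OF bounded_linear_cinner_left]) auto
    moreover have "complex_vector.subspace ?H"
      by (auto simp: complex_vector.subspace_def cinner_add_left cinner_scaleC_left)
    ultimately have "nontrivial_invariant_subspace T ?H"
      using 2 unfolding nontrivial_invariant_subspace_def by auto
    then show ?thesis by blast
  next
    case 3
    let ?H = "{z. T z = 0}"
    have "cinner (iter T n (T x)) y = 0" for n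
      using xy[of "Suc n"] by (simp add: funpow_swap1)
    then have "T x \<in> E" by (simp add: E_def)
    then have "x \<in> ?H" using 3 by simp
    moreover have "x \<noteq> 0" using xy[of 0] by auto
    moreover have "?H \<noteq> UNIV" using 3(2) by (metis (mono_tags) UNIV_I blinfun_eqI mem_Collect_eq zero_blinfun.rep_eq)
    moreover have "closed ?H" by (intro closed_Collect_eq blinfun.continuous_on) auto
    moreover have "complex_vector.subspace ?H"
      by (auto simp: complex_vector.subspace_def blinfun.add_right clinear_op_scaleC[OF T] blinfun.zero_right)
    ultimately have "nontrivial_invariant_subspace T ?H"
      unfolding nontrivial_invariant_subspace_def by (auto simp: blinfun.zero_right)
    then show ?thesis by blast
  qed
qed

theorem corollary7p3:
  shows "comeager_in SOT_star
    {T \<in> contractions. \<exists>E. nontrivial_invariant_subspace T E}"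
proof -
  let ?G = "{T \<in> contractions. \<exists>E. nontrivial_invariant_subspace T E}"
  obtain D :: "ell2 set" where D: "countable D" "0 \<in> D" "closure D = UNIV"
    by (rule ell2_countable_dense)
  define d :: "nat \<Rightarrow> real" where "d k = 2 / 2 ^ k" for k
  \<comment> \<open>Intersecting with the complement of \<open>?G\<close> makes the union equal to
    that complement, as \<open>meager_in\<close> requires an equality.\<close>
  define A where "A = (\<lambda>(k, x, y). (contractions - ?G) \<inter>
    ({T \<in> contractions. good (d k) T x y} - improvable D (d k) (d (Suc k)) x y))"
  have nd: "nowhere_dense_in SOT_star (A p)" for p
  proof -
    obtain k x y where p: "p = (k, x, y)" by (cases p)
    show ?thesis unfolding p A_def prod.case
      by (rule nowhere_dense_in_mono[OF nowhere_dense_in_closure_Diff[OF openin_improvable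
            good_subset_closure_improvable[OF D(3)]] Int_lower2]) (simp_all add: d_def)
  qed
  have cover: "contractions - ?G = \<Union>(A ` (UNIV \<times> D \<times> D))"
  proof
    show "\<Union>(A ` (UNIV \<times> D \<times> D)) \<subseteq> contractions - ?G" unfolding A_def by blast
    show "contractions - ?G \<subseteq> \<Union>(A ` (UNIV \<times> D \<times> D))"
    proof (rule subsetI, rule ccontr)
      fix T assume T: "T \<in> contractions - ?G" and nT: "T \<notin> \<Union>(A ` (UNIV \<times> D \<times> D))"
      then have Tc: "T \<in> contractions" by blast
      \<comment> \<open>Avoiding every \<open>A (k, x, y)\<close> while lying outside
        \<open>?G\<close> means that each good pair in \<open>D\<close> can be improved.\<close>
      have step: "T \<in> improvable D (2 / 2 ^ k) (2 / 2 ^ Suc k) x y"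
        if "x \<in> D" "y \<in> D" "good (2 / 2 ^ k) T x y" for k x y
      proof (rule ccontr)
        assume "T \<notin> improvable D (2 / 2 ^ k) (2 / 2 ^ Suc k) x y"
        then have "T \<in> A (k, x, y)"
          unfolding A_def d_def prod.case using T Tc that(3) by blast
        with nT that show False by blast
      qed
      obtain x y where "\<And>n. cinner (iter T n x) y = of_bool (n = 0)"
        using biorthogonal_if_improvable[OF Tc D(2) step] by blast
      then have "\<exists>E. nontrivial_invariant_subspace T E"
        by (rule invariant_subspace_if_biorthogonal[OF contractionsD(1)[OF Tc]])
      with T show False by blast
    qed
  qed
  have "countable (A ` (UNIV \<times> D \<times> D))" using D(1) by simp
  with nd cover have "meager_in SOT_star (contractions - ?G)"
    unfolding meager_in_def by blast
  then show ?thesis unfolding comeager_in_def topspace_SOT_star by blast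
qed

end
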